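(* Let $\epsilon>0$, and let $P$ and $Q$ be distributions on $\mathbb{R}^d$ with densities $p$ and $q$. Let $\mathcal{U}$ be a collection of open subsets of $\mathbb{S}^{d-1}$ that form a partition of $\mathbb{S}^{d-1}$, up to a set of zero measure. Consider $$\underset{K}{\mathrm{argmin}}\ \ \mathbb{E}_{P-Q}[\|\mathbf{x}\|_K]\quad\text{s.t.}\quad\mathrm{vol}(K)=1,\ \epsilon B^d\subseteq K,\ K\ \text{is piecewise constant over }U\in\mathcal{U}.$$ Then the optimal solution is the star set $\hat K$ whose radial function over each $U\in\mathcal{U}$ is given by $\rho_U$, where $$\rho_U=\begin{cases}\epsilon & \text{if }\ \sigma_U<\epsilon^{d+1}d\,w_U\lambda,\\[2pt] \epsilon\,\big(\sigma_U/(d\,w_U\lambda)\big)^{1/(d+1)} & \text{if }\ \sigma_U\ge\epsilon^{d+1}d\,w_U\lambda,\end{cases}$$ and where $\lambda$ is a scaling parameter such that $\sum_{U\in\mathcal{U}}\rho_U^d=1$. Here $w_U$ is the surface area of $U$ and $$\sigma_U=\int_{\mathbf{v}\in U}\int_{r=0}^\infty r^dp(r\mathbf{v})\,\mathrm{d}r\,\mathrm{d}\mathbf{v}-\int_{\mathbf{v}\in U}\int_{r=0}^\infty r^dq(r\mathbf{v})\,\mathrm{d}r\,\mathrm{d}\mathbf{v}.$$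
   Context: A set $K\subset\mathbb{R}^d$ is star if $[\mathbf{0},\mathbf{y}]\subset K$ for every $\mathbf{y}\in K$. Its radial function is $\rho_K(\mathbf{u})=\sup\{\lambda\ge0:\lambda\mathbf{u}\in K\}$ for $\mathbf{u}\in\mathbb{S}^{d-1}$ (the unit Euclidean sphere), and its gauge is $\|\mathbf{x}\|_K=\inf\{\lambda\ge0:\mathbf{x}\in\lambda K\}$. A star set $K$ is piecewise constant over $\mathcal{U}$ if $\rho_K$ is constant over each $U\in\mathcal{U}$. $\mathbb{E}_{P-Q}[\|\mathbf{x}\|_K]$ denotes $\mathbb{E}_P[\|\mathbf{x}\|_K]-\mathbb{E}_Q[\|\mathbf{x}\|_K]$. $B^d$ is the Euclidean unit ball, $\mathrm{vol}$ is $d$-dimensional volume, and $\mathrm{d}\mathbf{v}$ is surface measure on $\mathbb{S}^{d-1}$.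
   Formalization: The factor ε in the second case of ρ_U is dropped and Σρ_U^d=1 is replaced by (1/d)Σ w_U ρ_U^d=1 (i.e. vol(K)=1), as the printed formulas give infeasible K; P and Q have finite first moments, λ>0, and λ is shown to exist if vol(εB^d)<1 and some σ_U>0. *)

theory Defs
  imports "HOL-Probability.Probability"
begin

definition star_set :: "'a::real_vector set \<Rightarrow> bool" where
  "star_set K \<longleftrightarrow> (\<forall>y\<in>K. closed_segment 0 y \<subseteq> K)"

(* Extended-real valued: a star set may contain a whole ray, and then the supremum is infinite. *)
definition radial :: "'a::real_vector set \<Rightarrow> 'a \<Rightarrow> ereal" where
  "radial K u = (SUP t\<in>{t. 0 \<le> t \<and> t *\<^sub>R u \<in> K}. ereal t)"

(* The Minkowski functional (not the gauges of Henstock-Kurzweil integration).  It is real valued,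
   hence meaningful when some multiple of K contains x, e.g. when K contains a ball about 0. *)
definition star_gauge :: "'a::real_vector set \<Rightarrow> 'a \<Rightarrow> real" where
  "star_gauge K x = Inf {t. 0 \<le> t \<and> x \<in> (\<lambda>y. t *\<^sub>R y) ` K}"

definition piecewise_constant :: "'a::real_vector set set \<Rightarrow> 'a set \<Rightarrow> bool" where
  "piecewise_constant \<U> K \<longleftrightarrow> star_set K \<and> (\<forall>U\<in>\<U>. radial K constant_on U)"

(* Surface measure on the unit sphere: the area of A is d times the volume of the cone
   { r v | 0 < r < 1, v in A }.  For d = 1 it is counting measure on the two unit vectors. *)
definition sphere_measure :: "'a::euclidean_space measure" where
  "sphere_measure =
     scale_measure (of_nat DIM('a))
       (distr (restrict_space lborel (ball 0 1 - {0})) (restrict_space borel (sphere 0 1)) sgn)"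

lemma space_sphere_measure [simp]: "space sphere_measure = sphere (0::'a::euclidean_space) 1"
  by (simp add: sphere_measure_def space_scale_measure space_restrict_space)

lemma sets_sphere_measure [measurable_cong]:
  "sets sphere_measure = sets (restrict_space borel (sphere (0::'a::euclidean_space) 1))"
  by (simp add: sphere_measure_def)

lemma sgn_measurable_sphere:
  "sgn \<in> measurable (restrict_space lborel (ball 0 1 - {0})) 
           (restrict_space borel (sphere (0::'a::euclidean_space) 1))"
proof (rule measurable_restrict_space2)
  show "sgn \<in> space (restrict_space lborel (ball 0 1 - {0})) \<rightarrow> sphere (0::'a) 1"
    by (auto simp: space_restrict_space norm_sgn)
  have "continuous_on (ball 0 1 - {0::'a}) sgn"
    unfolding sgn_div_norm by (intro continuous_intros) auto
  then have "sgn \<in> borel_measurable (restrict_space borel (ball 0 1 - {0::'a}))"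
    by (rule borel_measurable_continuous_on_restrict)
  then show "sgn \<in> borel_measurable (restrict_space lborel (ball 0 1 - {0::'a}))"
    by (simp cong: measurable_cong_sets sets_restrict_space_cong)
qed

lemma emeasure_sphere_measure:
  assumes "A \<in> sets (sphere_measure :: 'a::euclidean_space measure)"
  shows "emeasure sphere_measure A =
           of_nat DIM('a) * emeasure lborel {r *\<^sub>R v | r v. 0 < r \<and> r < 1 \<and> v \<in> A}"
proof -
  have A: "A \<in> sets (restrict_space borel (sphere 0 1))"
    using assms by (simp add: sets_sphere_measure)
  have sub: "A \<subseteq> sphere 0 1"
    using sets.sets_into_space[OF A] by (simp add: space_restrict_space)
  have eq: "sgn -` A \<inter> (ball 0 1 - {0}) = {r *\<^sub>R v | r v. 0 < r \<and> r < 1 \<and> v \<in> A}" (is "?L = ?R")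
  proof
    show "?L \<subseteq> ?R"
    proof
      fix x :: 'a assume x: "x \<in> ?L"
      then have "x = norm x *\<^sub>R sgn x" "0 < norm x" "norm x < 1" "sgn x \<in> A"
        by (auto simp: sgn_div_norm)
      then show "x \<in> ?R" by blast
    qed
    show "?R \<subseteq> ?L"
    proof
      fix x assume "x \<in> ?R"
      then obtain r v where x: "x = r *\<^sub>R v" and rv: "0 < r" "r < 1" "v \<in> A"
        by blast
      then have "norm v = 1" using sub by auto
      then show "x \<in> ?L" using x rv by (auto simp: sgn_div_norm)
    qed
  qed
  have "emeasure sphere_measure A = of_nat DIM('a) *
          emeasure (restrict_space lborel (ball 0 1 - {0})) (sgn -` A \<inter> (ball 0 1 - {0}))"
    unfolding sphere_measure_def
    by (simp add: emeasure_distr[OF sgn_measurable_sphere A] space_restrict_space)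
  also have "emeasure (restrict_space lborel (ball 0 1 - {0})) (sgn -` A \<inter> (ball 0 1 - {0}))
      = emeasure lborel (sgn -` A \<inter> (ball 0 1 - {0}))"
    by (rule emeasure_restrict_space) auto
  finally show ?thesis unfolding eq .
qed

(* The blocks of a partition are non-empty.  Nothing bounds their number: the family is
   automatically countable, but it may be infinite. *)
definition open_partition_ae :: "'a::euclidean_space set set \<Rightarrow> bool" where
  "open_partition_ae \<U> \<longleftrightarrow>
     (\<forall>U\<in>\<U>. openin (top_of_set (sphere 0 1)) U \<and> U \<noteq> {}) \<and>
     disjoint \<U> \<and> emeasure sphere_measure (sphere 0 1 - \<Union>\<U>) = 0"

definition objective :: "'a::real_vector measure \<Rightarrow> 'a measure \<Rightarrow> 'a set \<Rightarrow> real" where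
  "objective P Q K = (\<integral>x. star_gauge K x \<partial>P) - (\<integral>x. star_gauge K x \<partial>Q)"

definition feasible :: "real \<Rightarrow> 'a::euclidean_space set set \<Rightarrow> 'a set \<Rightarrow> bool" where
  "feasible \<epsilon> \<U> K \<longleftrightarrow>
     measure lebesgue K = 1 \<and> cball 0 \<epsilon> \<subseteq> K \<and> piecewise_constant \<U> K"

definition area :: "'a::euclidean_space set \<Rightarrow> real" where
  "area U = measure sphere_measure U"

definition moment :: "('a::euclidean_space \<Rightarrow> real) \<Rightarrow> 'a set \<Rightarrow> real" where
  "moment p U = (LINT v:U|sphere_measure. (LINT r:{0..}|lborel. r ^ DIM('a) * p (r *\<^sub>R v)))"

definition moment_diff :: "('a::euclidean_space \<Rightarrow> real) \<Rightarrow> ('a \<Rightarrow> real) \<Rightarrow> 'a set \<Rightarrow> real" where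
  "moment_diff p q U = moment p U - moment q U"

(* No factor \<epsilon> in the second case: the two cases agree at the threshold
   \<sigma> = \<epsilon>^(d+1) d w lam, and the radius is never below \<epsilon>. *)
definition opt_radius ::
  "real \<Rightarrow> ('a::euclidean_space \<Rightarrow> real) \<Rightarrow> ('a \<Rightarrow> real) \<Rightarrow> real \<Rightarrow> 'a set \<Rightarrow> real" where
  "opt_radius \<epsilon> p q lam U =
     (if moment_diff p q U < \<epsilon> ^ (DIM('a) + 1) * real DIM('a) * area U * lam then \<epsilon>
      else (moment_diff p q U / (real DIM('a) * area U * lam)) powr (1 / (real DIM('a) + 1)))"

(* The scaling makes the volume 1: in polar coordinates, a star set with radius c U over each U
   has volume (1/d) * (sum over U of area U * c U ^ d).  An infinite sum equal to d is convergent,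
   because infsum is 0 on families that are not summable. *)
definition normalizing ::
  "real \<Rightarrow> 'a::euclidean_space set set \<Rightarrow> ('a \<Rightarrow> real) \<Rightarrow> ('a \<Rightarrow> real) \<Rightarrow> real \<Rightarrow> bool" where
  "normalizing \<epsilon> \<U> p q lam \<longleftrightarrow>
     0 < lam \<and> (1 / real DIM('a)) * (\<Sum>\<^sub>\<infinity>U\<in>\<U>. area U * opt_radius \<epsilon> p q lam U ^ DIM('a)) = 1"

end

theory Submission
  imports Defs
begin

text \<open>In polar coordinates a star set whose radial function is \<open>\<rho>\<^sub>U\<close> on each block \<open>U\<close> has volume
  \<open>(1/d) \<Sum> w\<^sub>U \<rho>\<^sub>U ^ d\<close> and objective \<open>\<Sum> \<sigma>\<^sub>U / \<rho>\<^sub>U\<close>.  On the feasible sets the objective therefore differs by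
  a constant from the Lagrangian \<open>\<Sum> (\<sigma>\<^sub>U / \<rho>\<^sub>U + \<lambda> w\<^sub>U \<rho>\<^sub>U ^ d)\<close>, which separates over the blocks; each summand
  has a unique minimiser on \<open>[\<epsilon>, \<infinity>)\<close>, by the strict Bernoulli inequality.  A scaling parameter exists
  by the intermediate value theorem in \<open>s = 1 / \<lambda>\<close>: the normalised volume is continuous on each
  \<open>[0, S]\<close> by the Weierstrass M-test, is below \<open>1\<close> at \<open>s = 0\<close> and is unbounded as \<open>s\<close> grows.\<close>

subsection \<open>Polar coordinates\<close>

text \<open>Feasible sets are not assumed measurable and \<open>\<U>\<close> may be infinite. The
  default values of \<open>measure\<close> settle the first point:
  \<open>measure lebesgue K = 1\<close> makes \<open>K\<close> measurable and of finite volume,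
  which also excludes infinite radii. For the second, volumes and moments are computed as
  nonnegative integrals over \<open>count_space \<U>\<close> and become real sums once they are
  known to be finite; the first moments of \<open>P\<close> and \<open>Q\<close> and the bound
  \<epsilon> on the radii make the two parts of the objective converge separately. The sign of
  \<open>moment_diff p q U\<close> is arbitrary, so a summand of the Lagrangian need not be convex
  in the radius. Each block is instead compared with the critical moment for which its optimal
  radius is stationary: the true moment equals it, or is smaller while the constraint binds and the
  radius can only grow. With \<open>s = 1 / lam\<close> the radii are powers of linear functions of
  \<open>s\<close>, cut off below at \<epsilon>, and \<open>s = 0\<close>, where every radius is
  \<epsilon>, is an admissible endpoint.\<close>

lemma nn_integral_sphere_measure:
  fixes f :: "'a::euclidean_space \<Rightarrow> ennreal"
  assumes [measurable]: "f \<in> borel_measurable sphere_measure"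
  shows "(\<integral>\<^sup>+v. f v \<partial>sphere_measure) =
    of_nat DIM('a) * (\<integral>\<^sup>+x. f (sgn x) * indicator (ball 0 1 - {0}) x \<partial>lborel)"
proof -
  have f: "f \<in> borel_measurable (restrict_space borel (sphere 0 1))"
    using assms by (simp cong: measurable_cong_sets add: sets_sphere_measure)
  have "(\<integral>\<^sup>+v. f v \<partial>sphere_measure) = of_nat DIM('a) *
      (\<integral>\<^sup>+v. f v \<partial>distr (restrict_space lborel (ball 0 1 - {0})) (restrict_space borel (sphere 0 1)) sgn)"
    unfolding sphere_measure_def by (rule nn_integral_scale_measure) (simp add: f)
  also have "(\<integral>\<^sup>+v. f v \<partial>distr (restrict_space lborel (ball 0 1 - {0})) (restrict_space borel (sphere 0 1)) sgn)
     = (\<integral>\<^sup>+x. f (sgn x) \<partial>restrict_space lborel (ball 0 1 - {0}))"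
    by (rule nn_integral_distr[OF sgn_measurable_sphere]) (simp add: f)
  also have "\<dots> = (\<integral>\<^sup>+x. f (sgn x) * indicator (ball 0 1 - {0}) x \<partial>lborel)"
    by (rule nn_integral_restrict_space) auto
  finally show ?thesis .
qed

lemma nn_integral_lborel_scaleR:
  fixes f :: "'a::euclidean_space \<Rightarrow> ennreal"
  assumes [measurable]: "f \<in> borel_measurable borel" and "0 < c"
  shows "(\<integral>\<^sup>+x. f x \<partial>lborel) = ennreal (c ^ DIM('a)) * (\<integral>\<^sup>+x. f (c *\<^sub>R x) \<partial>lborel)"
  using assms(2)
  by (subst lborel_affine[of c 0])
     (simp_all add: nn_integral_density nn_integral_distr nn_integral_cmult)

text \<open>The antiderivative \<open>- (inverse s ^ n / real n)\<close> vanishes at infinity. With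
  \<open>n = DIM('a)\<close> the value supplies the \<open>1 / DIM('a)\<close> that cancels the
  dimension factor built into \<open>sphere_measure\<close>.\<close>

lemma nn_integral_power_tail:
  assumes "0 < a" "0 < n"
  shows "(\<integral>\<^sup>+s. ennreal (inverse s ^ (n + 1)) * indicator {a<..} s \<partial>lborel) = ennreal (inverse a ^ n / real n)"
proof -
  have "(\<integral>\<^sup>+s. ennreal (inverse s ^ (n + 1)) * indicator {a<..} s \<partial>lborel) =
        (\<integral>\<^sup>+s. ennreal (inverse s ^ (n + 1)) * indicator {a..} s \<partial>lborel)"
    by (intro nn_integral_cong_AE eventually_mono[OF AE_lborel_singleton[of a]])
       (auto simp: indicator_def)
  also have "\<dots> = ennreal (0 - (- (inverse a ^ n / real n)))"
  proof (rule nn_integral_FTC_atLeast)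
    show "((\<lambda>s. - (inverse s ^ n / real n)) \<longlongrightarrow> 0) at_top"
      using assms by real_asymp
    fix s assume "a \<le> s"
    then have "0 < s" using assms by simp
    then show "((\<lambda>s. - (inverse s ^ n / real n)) has_real_derivative inverse s ^ (n + 1)) (at s)"
      using assms
      by (auto intro!: derivative_eq_intros simp: power_diff field_simps power2_eq_square)
    show "0 \<le> inverse s ^ (n + 1)" using \<open>0 < s\<close> by simp
  qed simp
  finally show ?thesis by simp
qed

text \<open>The sphere integral unfolds to one over the unit ball, with \<open>v = sgn x\<close>; the substitutions
  \<open>r = norm x * s\<close> and then \<open>y = s x\<close> under Fubini turn the sphere average into the weight
  \<open>norm y ^ d\<close> times the integral of \<open>s ^ (- d - 1)\<close> over \<open>s > norm y\<close>, which is \<open>1 / d\<close>.\<close>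

lemma nn_integral_polar:
  fixes f :: "'a::euclidean_space \<Rightarrow> ennreal"
  assumes [measurable]: "f \<in> borel_measurable borel"
  shows "(\<integral>\<^sup>+v. \<integral>\<^sup>+r. ennreal (r ^ (DIM('a) - 1)) * f (r *\<^sub>R v) * indicator {0<..} r \<partial>lborel \<partial>sphere_measure)
    = (\<integral>\<^sup>+x. f x \<partial>lborel)"
proof -
  let ?d = "DIM('a)"
  let ?B = "{x::'a. x \<noteq> 0 \<and> norm x < 1}"
  have d: "0 < ?d" by simp
  have B: "ball 0 1 - {0} = ?B" by auto
  have meas_id: "(\<lambda>v::'a. v) \<in> measurable sphere_measure borel"
    by (simp cong: measurable_cong_sets add: sets_sphere_measure measurable_restrict_space1)
  have "(\<lambda>v::'a. \<integral>\<^sup>+r. ennreal (r ^ (?d - 1)) * f (r *\<^sub>R v) * indicator {0<..} r \<partial>lborel) \<in> borel_measurable borel"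
    by measurable
  from measurable_compose[OF meas_id this]
  have "(\<integral>\<^sup>+v. \<integral>\<^sup>+r. ennreal (r ^ (?d - 1)) * f (r *\<^sub>R v) * indicator {0<..} r \<partial>lborel \<partial>sphere_measure)
    = ennreal ?d * (\<integral>\<^sup>+x. (\<integral>\<^sup>+r. ennreal (r ^ (?d - 1)) * f (r *\<^sub>R sgn x) * indicator {0<..} r \<partial>lborel) * indicator ?B x \<partial>lborel)"
    by (subst nn_integral_sphere_measure) (simp_all add: ennreal_of_nat_eq_real_of_nat B)
  also have "(\<integral>\<^sup>+x. (\<integral>\<^sup>+r. ennreal (r ^ (?d - 1)) * f (r *\<^sub>R sgn x) * indicator {0<..} r \<partial>lborel) * indicator ?B x \<partial>lborel)
     = (\<integral>\<^sup>+x. \<integral>\<^sup>+s. ennreal (norm x ^ ?d * s ^ (?d - 1)) * f (s *\<^sub>R x) * indicator {0<..} s * indicator ?B x \<partial>lborel \<partial>lborel)"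
  proof (rule nn_integral_cong)
    fix x :: 'a
    show "(\<integral>\<^sup>+r. ennreal (r ^ (?d - 1)) * f (r *\<^sub>R sgn x) * indicator {0<..} r \<partial>lborel) * indicator ?B x
      = (\<integral>\<^sup>+s. ennreal (norm x ^ ?d * s ^ (?d - 1)) * f (s *\<^sub>R x) * indicator {0<..} s * indicator ?B x \<partial>lborel)"
    proof (cases "x \<in> ?B")
      case True
      then have x: "x \<noteq> 0" "0 < norm x" by auto
      have "(\<integral>\<^sup>+r. ennreal (r ^ (?d - 1)) * f (r *\<^sub>R sgn x) * indicator {0<..} r \<partial>lborel)
        = ennreal (norm x) * (\<integral>\<^sup>+s. ennreal ((norm x * s) ^ (?d - 1)) * f ((norm x * s) *\<^sub>R sgn x) * indicator {0<..} (norm x * s) \<partial>lborel)"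
        by (subst nn_integral_real_affine[where c="norm x" and t=0]) (use x in auto)
      also have "\<dots> = (\<integral>\<^sup>+s. ennreal (norm x) * (ennreal ((norm x * s) ^ (?d - 1)) * f ((norm x * s) *\<^sub>R sgn x) * indicator {0<..} (norm x * s)) \<partial>lborel)"
        by (rule nn_integral_cmult[symmetric]) measurable
      also have "\<dots> = (\<integral>\<^sup>+s. ennreal (norm x ^ ?d * s ^ (?d - 1)) * f (s *\<^sub>R x) * indicator {0<..} s \<partial>lborel)"
      proof (rule nn_integral_cong)
        fix s :: real
        have 1: "(norm x * s) *\<^sub>R sgn x = s *\<^sub>R x" using x by (simp add: sgn_div_norm)
        have 2: "norm x * (norm x * s) ^ (?d - 1) = norm x ^ ?d * s ^ (?d - 1)"
          using power_Suc[of "norm x" "?d - 1"] by (simp add: power_mult_distrib)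
        show "ennreal (norm x) * (ennreal ((norm x * s) ^ (?d - 1)) * f ((norm x * s) *\<^sub>R sgn x) * indicator {0<..} (norm x * s))
          = ennreal (norm x ^ ?d * s ^ (?d - 1)) * f (s *\<^sub>R x) * indicator {0<..} s"
          unfolding 1 2[symmetric] using x
          by (cases "0 < s") (auto simp: ennreal_mult mult.assoc zero_less_mult_iff)
      qed
      finally show ?thesis using True by simp
    qed simp
  qed
  also have "\<dots> = (\<integral>\<^sup>+s. \<integral>\<^sup>+x. ennreal (norm x ^ ?d * s ^ (?d - 1)) * f (s *\<^sub>R x) * indicator {0<..} s * indicator ?B x \<partial>lborel \<partial>lborel)"
    by (rule lborel_pair.Fubini'[symmetric]) measurable
  \<comment> \<open>Exponents of \<open>s\<close>: \<open>norm x ^ ?d\<close> contributes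
    \<open>- ?d\<close>, the volume element another \<open>- ?d\<close>, and \<open>?d - 1\<close>
    is already there, in total \<open>- ?d - 1\<close>. The ball condition turns into
    \<open>norm y < s\<close>.\<close>
  also have "\<dots> = (\<integral>\<^sup>+s. \<integral>\<^sup>+y. ennreal (norm y ^ ?d * inverse s ^ (?d + 1)) * f y * (if y \<noteq> 0 \<and> norm y < s then 1 else 0) \<partial>lborel \<partial>lborel)"
  proof (rule nn_integral_cong)
    fix s :: real
    show "(\<integral>\<^sup>+x. ennreal (norm x ^ ?d * s ^ (?d - 1)) * f (s *\<^sub>R x) * indicator {0<..} s * indicator ?B x \<partial>lborel)
      = (\<integral>\<^sup>+y. ennreal (norm y ^ ?d * inverse s ^ (?d + 1)) * f y * (if y \<noteq> 0 \<and> norm y < s then 1 else 0) \<partial>lborel)"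
    proof (cases "0 < s")
      case True
      have "(\<integral>\<^sup>+y. ennreal (norm y ^ ?d * inverse s ^ (?d + 1)) * f y * (if y \<noteq> 0 \<and> norm y < s then 1 else 0) \<partial>lborel)
        = ennreal (s ^ ?d) * (\<integral>\<^sup>+x. ennreal (norm (s *\<^sub>R x) ^ ?d * inverse s ^ (?d + 1)) * f (s *\<^sub>R x) *
             (if s *\<^sub>R x \<noteq> 0 \<and> norm (s *\<^sub>R x) < s then 1 else 0) \<partial>lborel)"
        by (rule nn_integral_lborel_scaleR[OF _ True]) measurable
      also have "\<dots> = (\<integral>\<^sup>+x. ennreal (s ^ ?d) * (ennreal (norm (s *\<^sub>R x) ^ ?d * inverse s ^ (?d + 1)) * f (s *\<^sub>R x) *
             (if s *\<^sub>R x \<noteq> 0 \<and> norm (s *\<^sub>R x) < s then 1 else 0)) \<partial>lborel)"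
        by (rule nn_integral_cmult[symmetric]) measurable
      also have "\<dots> = (\<integral>\<^sup>+x. ennreal (norm x ^ ?d * s ^ (?d - 1)) * f (s *\<^sub>R x) * indicator {0<..} s * indicator ?B x \<partial>lborel)"
      proof (rule nn_integral_cong)
        fix x :: 'a
        have *: "s ^ ?d = s * s ^ (?d - 1)"
          using power_Suc[of s "?d - 1"] by simp
        have "s ^ ?d * (norm (s *\<^sub>R x) ^ ?d * inverse s ^ (?d + 1)) = norm x ^ ?d * s ^ (?d - 1)"
          using True * by (simp add: power_mult_distrib field_simps)
        then have "ennreal (s ^ ?d) * ennreal (norm (s *\<^sub>R x) ^ ?d * inverse s ^ (?d + 1)) = ennreal (norm x ^ ?d * s ^ (?d - 1))"
          using True by (subst ennreal_mult[symmetric]) auto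
        then show "ennreal (s ^ ?d) * (ennreal (norm (s *\<^sub>R x) ^ ?d * inverse s ^ (?d + 1)) * f (s *\<^sub>R x) *
             (if s *\<^sub>R x \<noteq> 0 \<and> norm (s *\<^sub>R x) < s then 1 else 0))
          = ennreal (norm x ^ ?d * s ^ (?d - 1)) * f (s *\<^sub>R x) * indicator {0<..} s * indicator ?B x"
          using True by (simp add: mult.assoc[symmetric] del: norm_scaleR) (use True in \<open>auto simp: indicator_def\<close>)
      qed
      finally show ?thesis by simp
    next
      case False
      then have "\<not> norm y < s" for y :: 'a
        using norm_ge_zero[of y] by linarith
      then show ?thesis using False by simp
    qed
  qed
  also have "\<dots> = (\<integral>\<^sup>+y. \<integral>\<^sup>+s. ennreal (norm y ^ ?d * inverse s ^ (?d + 1)) * f y * (if y \<noteq> 0 \<and> norm y < s then 1 else 0) \<partial>lborel \<partial>lborel)"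
    by (rule lborel_pair.Fubini') measurable
  also have "\<dots> = (\<integral>\<^sup>+y. ennreal (1 / ?d) * (f y * (if y \<noteq> 0 then 1 else 0)) \<partial>lborel)"
  proof (rule nn_integral_cong)
    fix y :: 'a
    show "(\<integral>\<^sup>+s. ennreal (norm y ^ ?d * inverse s ^ (?d + 1)) * f y * (if y \<noteq> 0 \<and> norm y < s then 1 else 0) \<partial>lborel)
       = ennreal (1 / ?d) * (f y * (if y \<noteq> 0 then 1 else 0))"
    proof (cases "y = 0")
      case False
      then have y: "0 < norm y" by simp
      have "(\<integral>\<^sup>+s. ennreal (norm y ^ ?d * inverse s ^ (?d + 1)) * f y * (if y \<noteq> 0 \<and> norm y < s then 1 else 0) \<partial>lborel)
         = (\<integral>\<^sup>+s. (f y * ennreal (norm y ^ ?d)) * (ennreal (inverse s ^ (?d + 1)) * indicator {norm y<..} s) \<partial>lborel)"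
        unfolding ennreal_mult'[OF zero_le_power[OF norm_ge_zero]] using False
        by (intro nn_integral_cong) (auto simp: indicator_def mult_ac)
      also have "\<dots> = (f y * ennreal (norm y ^ ?d)) * ennreal (inverse (norm y) ^ ?d / ?d)"
        unfolding nn_integral_power_tail[OF y d, symmetric] by (rule nn_integral_cmult) measurable
      also have "\<dots> = ennreal (1 / ?d) * f y"
      proof -
        have "norm y ^ ?d * (inverse (norm y) ^ ?d / ?d) = 1 / ?d"
          using y by (simp add: field_simps)
        then have "ennreal (norm y ^ ?d) * ennreal (inverse (norm y) ^ ?d / ?d) = ennreal (1 / ?d)"
          by (subst ennreal_mult[symmetric]) auto
        then show ?thesis by (simp add: mult.assoc mult.commute)
      qed
      finally show ?thesis using False by simp
    qed simp
  qed
  also have "\<dots> = ennreal (1 / ?d) * (\<integral>\<^sup>+y. f y * (if y \<noteq> 0 then 1 else 0) \<partial>lborel)"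
    by (rule nn_integral_cmult) measurable
  also have "(\<integral>\<^sup>+y. f y * (if y \<noteq> 0 then 1 else 0) \<partial>lborel) = (\<integral>\<^sup>+y. f y \<partial>lborel)"
    by (intro nn_integral_cong_AE eventually_mono[OF AE_lborel_singleton[of 0]]) (auto simp: indicator_def)
  finally show ?thesis
    by (simp add: mult.assoc[symmetric] ennreal_mult[symmetric])
qed

subsection \<open>Cones over the blocks of the partition\<close>

text \<open>Unbounded cones instead of blocks on the sphere: up to a null set they partition the
  whole space, so volumes and expectations split over the blocks by countable additivity.\<close>

definition dir_cone :: "'a::real_normed_vector set \<Rightarrow> 'a set" where
  "dir_cone U = {x. x \<noteq> 0 \<and> sgn x \<in> U}"

lemma sgn_in_sphere: "x \<noteq> (0::'a::real_normed_vector) \<Longrightarrow> sgn x \<in> sphere 0 1"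
  by (simp add: norm_sgn)

lemma scaleR_mem_dir_cone_iff: "0 < c \<Longrightarrow> c *\<^sub>R x \<in> dir_cone U \<longleftrightarrow> x \<in> dir_cone U"
  by (simp add: dir_cone_def sgn_scaleR)

lemma sets_sphere_measure_borel:
  "U \<in> sets (sphere_measure :: 'a::euclidean_space measure) \<Longrightarrow> U \<in> sets borel \<and> U \<subseteq> sphere 0 1"
  by (auto simp: sets_sphere_measure sets_restrict_space)

lemma open_dir_cone:
  fixes U :: "'a::euclidean_space set"
  assumes "openin (top_of_set (sphere 0 1)) U"
  shows "open (dir_cone U)"
proof -
  obtain T where T: "open T" "U = sphere 0 1 \<inter> T" using assms by (auto simp: openin_open)
  have "continuous_on (- {0::'a}) sgn"
    unfolding sgn_div_norm by (intro continuous_intros) auto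
  then have "open (- {0} \<inter> sgn -` T)"
    by (rule continuous_open_preimage) (use T in auto)
  also have "- {0} \<inter> sgn -` T = dir_cone U"
    using T by (auto simp: dir_cone_def norm_sgn)
  finally show ?thesis .
qed

lemma openin_sphere_sets:
  fixes U :: "'a::euclidean_space set"
  assumes "openin (top_of_set (sphere 0 1)) U"
  shows "U \<in> sets sphere_measure"
proof -
  obtain T where "open T" "U = sphere 0 1 \<inter> T" using assms unfolding openin_open by blast
  then show ?thesis
    unfolding sets_sphere_measure sets_restrict_space by (intro image_eqI[of _ _ T]) auto
qed

lemma dir_cone_borel [measurable]:
  fixes U :: "'a::euclidean_space set"
  assumes "U \<in> sets sphere_measure"
  shows "dir_cone U \<in> sets borel"
proof -
  have [measurable]: "U \<in> sets borel" using sets_sphere_measure_borel[OF assms] by simp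
  show ?thesis unfolding dir_cone_def sgn_div_norm by measurable
qed

lemma emeasure_sphere_dir_cone:
  fixes U :: "'a::euclidean_space set"
  assumes "U \<in> sets sphere_measure"
  shows "emeasure sphere_measure U = ennreal (real DIM('a)) * emeasure lborel (dir_cone U \<inter> ball 0 1)"
proof -
  have "{r *\<^sub>R v | r v. 0 < r \<and> r < 1 \<and> v \<in> U} = dir_cone U \<inter> ball 0 1" (is "?L = ?R")
  proof (intro equalityI subsetI)
    fix x assume "x \<in> ?L"
    then obtain r v where x: "x = r *\<^sub>R v" "0 < r" "r < 1" "v \<in> U" by blast
    then have "norm v = 1" using sets_sphere_measure_borel[OF assms] by auto
    then show "x \<in> ?R" using x by (auto simp: dir_cone_def sgn_scaleR sgn_div_norm)
  next
    fix x assume "x \<in> ?R"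
    then have "x = norm x *\<^sub>R sgn x" "0 < norm x" "norm x < 1" "sgn x \<in> U"
      by (auto simp: dir_cone_def sgn_div_norm)
    then show "x \<in> ?L" by blast
  qed
  then show ?thesis
    using emeasure_sphere_measure[OF assms] by (simp add: ennreal_of_nat_eq_real_of_nat)
qed

lemma emeasure_sphere_eq_area:
  fixes U :: "'a::euclidean_space set"
  assumes "U \<in> sets sphere_measure"
  shows "emeasure sphere_measure U = ennreal (area U)"
proof -
  have "emeasure lborel (dir_cone U \<inter> ball 0 1) \<le> emeasure lborel (ball (0::'a) 1)"
    by (intro emeasure_mono) auto
  also have "\<dots> < \<infinity>" by (rule emeasure_bounded_finite) simp
  finally have "emeasure sphere_measure U < \<infinity>"
    by (simp add: emeasure_sphere_dir_cone[OF assms] ennreal_mult_less_top)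
  then show ?thesis unfolding area_def by (simp add: emeasure_eq_ennreal_measure)
qed

lemma area_nonneg: "0 \<le> area U"
  by (simp add: area_def)

text \<open>Cones are invariant under positive scaling, which reduces the claim to the unit ball,
  where it is the definition of surface measure solved for the volume.\<close>

lemma emeasure_dir_cone_ball:
  fixes U :: "'a::euclidean_space set"
  assumes U: "U \<in> sets sphere_measure" and b: "0 < b"
  shows "emeasure lborel (dir_cone U \<inter> ball 0 b) = ennreal (area U * b ^ DIM('a) / DIM('a))"
proof -
  have [measurable]: "dir_cone U \<in> sets borel" by (rule dir_cone_borel[OF U])
  have "emeasure lborel (dir_cone U \<inter> ball 0 b) = (\<integral>\<^sup>+x. indicator (dir_cone U \<inter> ball 0 b) x \<partial>lborel)"
    by (intro nn_integral_indicator[symmetric]) simp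
  also have "\<dots> = ennreal (b ^ DIM('a)) * (\<integral>\<^sup>+x. indicator (dir_cone U \<inter> ball 0 b) (b *\<^sub>R x) \<partial>lborel)"
    by (rule nn_integral_lborel_scaleR[OF _ b]) (intro borel_measurable_indicator, simp)
  also have "(\<lambda>x. indicator (dir_cone U \<inter> ball 0 b) (b *\<^sub>R x)) = (indicator (dir_cone U \<inter> ball 0 1) :: 'a \<Rightarrow> ennreal)"
    using b by (auto simp: indicator_def scaleR_mem_dir_cone_iff fun_eq_iff)
  also have "(\<integral>\<^sup>+x. indicator (dir_cone U \<inter> ball 0 1) x \<partial>lborel) = emeasure lborel (dir_cone U \<inter> ball 0 1)"
    by (intro nn_integral_indicator) simp
  also have "\<dots> = ennreal (area U / DIM('a))"
  proof -
    have "ennreal (area U / DIM('a)) = ennreal (1 / DIM('a)) * (ennreal (real DIM('a)) * emeasure lborel (dir_cone U \<inter> ball 0 1))"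
      unfolding emeasure_sphere_dir_cone[OF U, symmetric] emeasure_sphere_eq_area[OF U]
      by (subst ennreal_mult[symmetric]) (auto simp: area_nonneg)
    then show ?thesis by (simp add: mult.assoc[symmetric] ennreal_mult[symmetric])
  qed
  also have "ennreal (b ^ DIM('a)) * \<dots> = ennreal (area U * b ^ DIM('a) / DIM('a))"
    using b by (subst ennreal_mult[symmetric]) (auto simp: area_nonneg mult_ac)
  finally show ?thesis .
qed

lemma area_pos:
  fixes U :: "'a::euclidean_space set"
  assumes "openin (top_of_set (sphere 0 1)) U" "U \<noteq> {}"
  shows "0 < area U"
proof (rule ccontr)
  assume "\<not> 0 < area U"
  then have "area U = 0" using area_nonneg[of U] by simp
  \<comment> \<open>Radius \<open>2\<close> because the open unit ball would miss the unit vectors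
    of \<open>U\<close>, one of which witnesses non-emptiness below.\<close>
  then have null: "emeasure lborel (dir_cone U \<inter> ball 0 2) = 0"
    using emeasure_dir_cone_ball[OF openin_sphere_sets[OF assms(1)], of 2] by simp
  have "open (dir_cone U \<inter> ball 0 2)" using open_dir_cone[OF assms(1)] by auto
  moreover obtain u where "u \<in> U" using assms by auto
  then have "norm u = 1" using openin_imp_subset[OF assms(1)] by auto
  then have "u \<in> dir_cone U \<inter> ball 0 2" using \<open>u \<in> U\<close> by (auto simp: dir_cone_def sgn_div_norm)
  ultimately have "\<not> negligible (dir_cone U \<inter> ball 0 2)"
    by (intro open_not_negligible) auto
  moreover have "dir_cone U \<inter> ball 0 2 \<in> sets borel"
    using dir_cone_borel[OF openin_sphere_sets[OF assms(1)]] by simp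
  then have "negligible (dir_cone U \<inter> ball 0 2)"
    using null by (simp add: negligible_iff_null_sets null_sets_def)
  ultimately show False by simp
qed

section \<open>Countable sums over the blocks\<close>

text \<open>The bridge from measure theory, where decompositions need no convergence, to the real
  sums of the Lagrangian argument. The condition \<open>0 \<le> c\<close> matters because
  \<open>ennreal\<close> maps negative numbers to \<open>0\<close>.\<close>

lemma nn_integral_count_space_iff_has_sum:
  fixes f :: "'a \<Rightarrow> real"
  assumes "\<And>x. x \<in> A \<Longrightarrow> 0 \<le> f x" "0 \<le> c"
  shows "(\<integral>\<^sup>+x. ennreal (f x) \<partial>count_space A) = ennreal c \<longleftrightarrow> (f has_sum c) A"
proof -
  have abs_iff: "Infinite_Set_Sum.abs_summable_on f A \<longleftrightarrow> f summable_on A"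
    using abs_summable_equivalent[of f A] assms(1) summable_on_cong[of A "\<lambda>x. norm (f x)" f] by simp
  show ?thesis
  proof
    assume L: "(\<integral>\<^sup>+x. ennreal (f x) \<partial>count_space A) = ennreal c"
    have "integrable (count_space A) f"
      by (rule integrableI_nonneg) (use assms L in \<open>auto simp: AE_count_space\<close>)
    then have s: "Infinite_Set_Sum.abs_summable_on f A" by (simp add: abs_summable_on_def)
    then have "ennreal (infsum f A) = ennreal c"
      using nn_integral_conv_infsetsum[OF s] assms(1) L infsetsum_infsum[OF s] by simp
    then have "infsum f A = c" using assms by (simp add: infsum_nonneg)
    then show "(f has_sum c) A" using s abs_iff by (auto intro: has_sum_infsum)
  next
    assume R: "(f has_sum c) A"
    then have s: "Infinite_Set_Sum.abs_summable_on f A" using abs_iff by (auto simp: summable_on_def)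
    then show "(\<integral>\<^sup>+x. ennreal (f x) \<partial>count_space A) = ennreal c"
      using nn_integral_conv_infsetsum[OF s] assms(1) infsetsum_infsum[OF s] infsumI[OF R] by simp
  qed
qed

lemma open_partition_ae_sets: "open_partition_ae \<U> \<Longrightarrow> U \<in> \<U> \<Longrightarrow> U \<in> sets sphere_measure"
  by (auto simp: open_partition_ae_def openin_sphere_sets)

lemma open_partition_ae_area_pos: "open_partition_ae \<U> \<Longrightarrow> U \<in> \<U> \<Longrightarrow> 0 < area U"
  by (auto simp: open_partition_ae_def area_pos)

lemma disjoint_family_dir_cone: "disjoint \<U> \<Longrightarrow> disjoint_family_on dir_cone \<U>"
  by (auto simp: disjoint_def disjoint_family_on_def dir_cone_def)

text \<open>The cones over the blocks are disjoint open sets of the full space, hence countably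
  many. Being non-empty and disjoint, they determine their blocks, so countability passes back to
  \<open>\<U>\<close>.\<close>

lemma open_partition_ae_countable:
  fixes \<U> :: "'a::euclidean_space set set"
  assumes "open_partition_ae \<U>"
  shows "countable \<U>"
proof -
  have ne: "dir_cone U \<noteq> {}" if "U \<in> \<U>" for U
  proof -
    have "U \<noteq> {}" using assms that by (simp add: open_partition_ae_def)
    then obtain u where u: "u \<in> U" by blast
    then have "norm u = 1" using open_partition_ae_sets[OF assms that] sets_sphere_measure_borel by fastforce
    then have "u \<in> dir_cone U" using u by (auto simp: dir_cone_def sgn_div_norm)
    then show ?thesis by auto
  qed
  have disj: "dir_cone U \<inter> dir_cone V = {}" if "U \<in> \<U>" "V \<in> \<U>" "U \<noteq> V" for U V
    using disjoint_family_dir_cone[of \<U>] assms that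
    by (auto simp: open_partition_ae_def disjoint_family_on_def)
  have "countable (dir_cone ` \<U>)"
    by (rule countable_disjoint_open_subsets)
       (use assms disj in \<open>auto simp: open_partition_ae_def open_dir_cone pairwise_def disjnt_def\<close>)
  moreover have "inj_on dir_cone \<U>"
    using ne disj by (metis Int_absorb inj_onI)
  ultimately show ?thesis by (rule countable_image_inj_on)
qed

text \<open>The cone over the uncovered part of the sphere is exhausted by its truncations at
  integer radii, each of volume \<open>0\<close> because that part has area
  \<open>0\<close>.\<close>

lemma open_partition_ae_AE:
  fixes \<U> :: "'a::euclidean_space set set"
  assumes "open_partition_ae \<U>"
  shows "AE x in lebesgue. x \<in> (\<Union>U\<in>\<U>. dir_cone U)"
proof -
  let ?S = "sphere 0 1 - \<Union>\<U>"
  have "\<Union>\<U> \<in> sets sphere_measure"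
    using open_partition_ae_sets[OF assms] open_partition_ae_countable[OF assms] by auto
  then have S: "?S \<in> sets sphere_measure"
    using sets.compl_sets[of "\<Union>\<U>" "sphere_measure"] by simp
  have area: "area ?S = 0" using assms by (simp add: open_partition_ae_def area_def measure_def)
  have "AE x in lborel. x \<notin> dir_cone ?S \<inter> ball 0 (real (Suc n))" for n
    using emeasure_dir_cone_ball[OF S, of "real (Suc n)"] area dir_cone_borel[OF S]
    by (intro AE_not_in) (auto simp: null_sets_def)
  then have "AE x in lborel. \<forall>n. x \<notin> dir_cone ?S \<inter> ball 0 (real (Suc n))"
    unfolding AE_all_countable by blast
  moreover have "AE x in lborel. x \<noteq> (0::'a)" by (rule AE_lborel_singleton)
  ultimately have "AE x in lborel. x \<in> (\<Union>U\<in>\<U>. dir_cone U)"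
  proof eventually_elim
    case (elim x)
    obtain n where "norm x < real (Suc n)"
      using reals_Archimedean2[of "norm x"] by (metis less_Suc_eq of_nat_less_iff order_less_trans)
    then have "x \<notin> dir_cone ?S" using elim by auto
    then show ?case using elim sgn_in_sphere[of x] by (auto simp: dir_cone_def)
  qed
  then show ?thesis by (rule AE_completion)
qed

text \<open>Countable additivity of \<open>density lebesgue f\<close>. The completed measure is used
  because the gauge of a feasible set is only known to be Lebesgue measurable.\<close>

lemma nn_integral_open_partition:
  fixes f :: "'a::euclidean_space \<Rightarrow> ennreal"
  assumes "open_partition_ae \<U>" and [measurable]: "f \<in> borel_measurable lebesgue"
  shows "(\<integral>\<^sup>+x. f x \<partial>lebesgue) = (\<integral>\<^sup>+U. (\<integral>\<^sup>+x. f x * indicator (dir_cone U) x \<partial>lebesgue) \<partial>count_space \<U>)"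
proof -
  have meas: "dir_cone U \<in> sets lebesgue" if "U \<in> \<U>" for U
    using dir_cone_borel[OF open_partition_ae_sets[OF assms(1) that]] by simp
  then have M: "(\<Union>U\<in>\<U>. dir_cone U) \<in> sets lebesgue"
    using open_partition_ae_countable[OF assms(1)] by (auto intro!: sets.countable_UN')
  have "(\<integral>\<^sup>+x. f x \<partial>lebesgue) = (\<integral>\<^sup>+x. f x * indicator (\<Union>U\<in>\<U>. dir_cone U) x \<partial>lebesgue)"
    using open_partition_ae_AE[OF assms(1)] by (intro nn_integral_cong_AE) (auto elim!: eventually_mono simp: indicator_def)
  also have "\<dots> = emeasure (density lebesgue f) (\<Union>U\<in>\<U>. dir_cone U)"
    by (rule emeasure_density[symmetric]) (use M in auto)
  also have "\<dots> = (\<integral>\<^sup>+U. emeasure (density lebesgue f) (dir_cone U) \<partial>count_space \<U>)"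
    by (rule emeasure_UN_countable)
       (use meas open_partition_ae_countable[OF assms(1)] assms(1) in \<open>auto simp: open_partition_ae_def disjoint_family_dir_cone\<close>)
  also have "\<dots> = (\<integral>\<^sup>+U. (\<integral>\<^sup>+x. f x * indicator (dir_cone U) x \<partial>lebesgue) \<partial>count_space \<U>)"
    by (intro nn_integral_cong emeasure_density) (use meas in auto)
  finally show ?thesis .
qed

subsection \<open>Volume and gauge of a piecewise constant star set\<close>

lemma radial_upper:
  assumes "radial K u = ereal \<rho>" "0 \<le> t" "t *\<^sub>R u \<in> K"
  shows "t \<le> \<rho>"
proof -
  have "ereal t \<le> radial K u"
    unfolding radial_def by (rule SUP_upper) (use assms in auto)
  then show ?thesis using assms by simp
qed

text \<open>The supremum need not be attained, hence the strict inequality: some point of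
  \<open>K\<close> lies farther out on the ray, and its segment to the origin passes through
  \<open>t *\<^sub>R u\<close>.\<close>

lemma radial_mem:
  assumes "star_set K" "ereal t < radial K u" "0 \<le> t"
  shows "t *\<^sub>R u \<in> K"
proof -
  obtain t' where t': "0 \<le> t'" "t' *\<^sub>R u \<in> K" "t < t'"
    using assms(2) unfolding radial_def less_SUP_iff by auto
  have "t *\<^sub>R u = (1 - t / t') *\<^sub>R 0 + (t / t') *\<^sub>R (t' *\<^sub>R u)" using t' assms by simp
  then have "t *\<^sub>R u \<in> closed_segment 0 (t' *\<^sub>R u)"
    unfolding closed_segment_def using t' assms(3) by (auto intro!: exI[of _ "t / t'"])
  then show ?thesis using assms(1) t' by (auto simp: star_set_def)
qed

lemma radial_ge:
  assumes "cball 0 \<epsilon> \<subseteq> K" "norm u = 1" "0 \<le> \<epsilon>"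
  shows "ereal \<epsilon> \<le> radial K u"
  unfolding radial_def by (rule SUP_upper) (use assms in \<open>auto simp: subset_iff\<close>)

lemma star_gauge_eq:
  assumes K: "star_set K" and x: "x \<noteq> 0" and \<rho>: "radial K (sgn x) = ereal \<rho>" "0 < \<rho>"
  shows "star_gauge K x = norm x / \<rho>"
proof -
  let ?S = "{t. 0 \<le> t \<and> x \<in> (\<lambda>y. t *\<^sub>R y) ` K}"
  \<comment> \<open>Strict, since the boundary point in direction \<open>sgn x\<close> may be
    missing from \<open>K\<close>; density of the reals then still gives the infimum.\<close>
  have mem: "t \<in> ?S" if t: "norm x / \<rho> < t" for t
  proof -
    have t0: "0 < t" using t \<rho> x by (smt (verit) divide_pos_pos zero_less_norm_iff)
    then have "norm x / t < \<rho>" using t \<rho> by (simp add: field_simps)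
    then have "(norm x / t) *\<^sub>R sgn x \<in> K" using radial_mem[OF K, of "norm x / t" "sgn x"] \<rho> t0 by simp
    moreover have "x = t *\<^sub>R ((norm x / t) *\<^sub>R sgn x)" using t0 x by (simp add: sgn_div_norm)
    ultimately have "x \<in> (\<lambda>y. t *\<^sub>R y) ` K" by (rule rev_image_eqI)
    then show ?thesis using t0 by simp
  qed
  have "Inf ?S = norm x / \<rho>"
  proof (rule cInf_eq_non_empty)
    show "?S \<noteq> {}" using mem[of "norm x / \<rho> + 1"] by (metis empty_iff less_add_one)
  next
    fix t assume "t \<in> ?S"
    then obtain y where y: "y \<in> K" "x = t *\<^sub>R y" "0 \<le> t" by auto
    then have t: "0 < t" using x by (cases "t = 0") auto
    have "sgn x = sgn y" "norm x / t = norm y" "y \<noteq> 0" using y t x by (auto simp: sgn_scaleR)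
    then have "y = (norm x / t) *\<^sub>R sgn x" by (simp add: sgn_div_norm)
    then have "norm x / t \<le> \<rho>" using radial_upper[OF \<rho>(1), of "norm x / t"] y t by simp
    then show "norm x / \<rho> \<le> t" using t \<rho> by (simp add: field_simps)
  next
    fix m assume m: "\<And>t. t \<in> ?S \<Longrightarrow> m \<le> t"
    show "m \<le> norm x / \<rho>" by (rule dense_ge) (use m mem in blast)
  qed
  then show ?thesis by (simp add: star_gauge_def)
qed

text \<open>Inside the cone over \<open>U\<close>, the set \<open>K\<close> lies between the open
  and the closed ball of radius \<open>\<rho> U\<close>. It therefore agrees with a Borel union of
  truncated cones up to countably many spheres and the null set outside all cones, and completeness
  makes \<open>K\<close> measurable.\<close>

lemma emeasure_star_set:
  fixes \<U> :: "'a::euclidean_space set set"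
  assumes \<U>: "open_partition_ae \<U>" and K: "star_set K"
    and \<rho>: "\<And>U u. U \<in> \<U> \<Longrightarrow> u \<in> U \<Longrightarrow> radial K u = ereal (\<rho> U)" "\<And>U. U \<in> \<U> \<Longrightarrow> 0 < \<rho> U"
  shows "K \<in> sets lebesgue"
    and "emeasure lebesgue K = (\<integral>\<^sup>+U. ennreal (area U * \<rho> U ^ DIM('a) / DIM('a)) \<partial>count_space \<U>)"
proof -
  let ?C = "\<lambda>U. dir_cone U \<inter> ball 0 (\<rho> U)"
  note cnt = open_partition_ae_countable[OF \<U>]
  have meas: "?C U \<in> sets borel" if "U \<in> \<U>" for U
    using dir_cone_borel[OF open_partition_ae_sets[OF \<U> that]] by simp
  have K0: "(\<Union>U\<in>\<U>. ?C U) \<in> sets borel"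
    using cnt meas by (auto intro!: sets.countable_UN')
  have sph: "AE x::'a in lebesgue. \<forall>U\<in>\<U>. norm x \<noteq> \<rho> U"
    unfolding AE_ball_countable[OF cnt]
  proof
    fix U
    have "negligible (sphere (0::'a) (\<rho> U))" by (rule negligible_sphere)
    then show "AE x::'a in lebesgue. norm x \<noteq> \<rho> U"
      unfolding eventually_ae_filter_negligible by (intro exI[of _ "sphere 0 (\<rho> U)"]) auto
  qed
  have AE: "AE x in lebesgue. x \<in> (\<Union>U\<in>\<U>. ?C U) \<longleftrightarrow> x \<in> K"
    using sph open_partition_ae_AE[OF \<U>]
  proof eventually_elim
    case (elim x)
    then obtain U where U: "U \<in> \<U>" "x \<in> dir_cone U" by auto
    then have x: "x \<noteq> 0" "sgn x \<in> U" by (auto simp: dir_cone_def)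
    then have xe: "x = norm x *\<^sub>R sgn x" by (simp add: sgn_div_norm)
    have r: "radial K (sgn x) = ereal (\<rho> U)" using \<rho> U x by auto
    show ?case
    proof
      assume "x \<in> (\<Union>U\<in>\<U>. ?C U)"
      then obtain V where V: "V \<in> \<U>" "x \<in> dir_cone V" "norm x < \<rho> V" by auto
      then have "radial K (sgn x) = ereal (\<rho> V)" using \<rho> by (auto simp: dir_cone_def)
      then have "norm x *\<^sub>R sgn x \<in> K" using V by (intro radial_mem[OF K]) auto
      then show "x \<in> K" using xe by simp
    next
      assume "x \<in> K"
      then have "norm x \<le> \<rho> U" using radial_upper[OF r, of "norm x"] xe by simp
      then show "x \<in> (\<Union>U\<in>\<U>. ?C U)" using elim U by (auto simp: less_le)
    qed
  qed
  then obtain N where N: "negligible N" "{x. \<not> (x \<in> (\<Union>U\<in>\<U>. ?C U) \<longleftrightarrow> x \<in> K)} \<subseteq> N"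
    unfolding eventually_ae_filter_negligible by auto
  have neg: "negligible (((\<Union>U\<in>\<U>. ?C U) - K) \<union> (K - (\<Union>U\<in>\<U>. ?C U)))"
    by (rule negligible_subset[OF N(1)]) (use N(2) in blast)
  have K0': "(\<Union>U\<in>\<U>. ?C U) \<in> sets lebesgue"
    using K0 by (metis sets_completionI_sets sets_lborel)
  show Ks: "K \<in> sets lebesgue"
    by (rule sets_negligible_symdiff[OF K0' neg])
  have "emeasure lebesgue K = emeasure lebesgue (\<Union>U\<in>\<U>. ?C U)"
    by (rule emeasure_eq_AE[OF AE K0' Ks, symmetric])
  also have "\<dots> = (\<integral>\<^sup>+U. emeasure lebesgue (?C U) \<partial>count_space \<U>)"
  proof (rule emeasure_UN_countable)
    have "disjoint_family_on dir_cone \<U>"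
      using \<U> by (simp add: disjoint_family_dir_cone open_partition_ae_def)
    then show "disjoint_family_on ?C \<U>" by (auto simp: disjoint_family_on_def)
  qed (use cnt meas in auto)
  also have "\<dots> = (\<integral>\<^sup>+U. ennreal (area U * \<rho> U ^ DIM('a) / DIM('a)) \<partial>count_space \<U>)"
    using open_partition_ae_sets[OF \<U>] \<rho>(2) meas
    by (intro nn_integral_cong) (simp add: emeasure_dir_cone_ball)
  finally show "emeasure lebesgue K = (\<integral>\<^sup>+U. ennreal (area U * \<rho> U ^ DIM('a) / DIM('a)) \<partial>count_space \<U>)" .
qed

section \<open>Moments and expected gauges\<close>

text \<open>\<open>moment\<close> is an iterated Bochner integral, whose inner part silently becomes
  \<open>0\<close> in directions where it diverges. The finite first moment confines such directions
  within \<open>U\<close> to a null set, so polar coordinates apply.\<close>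

lemma moment_eq_nn_integral:
  fixes p :: "'a::euclidean_space \<Rightarrow> real"
  assumes [measurable]: "p \<in> borel_measurable borel" and p0: "\<And>x. 0 \<le> p x"
    and fin: "(\<integral>\<^sup>+x. ennreal (norm x * p x) \<partial>lborel) < \<infinity>"
    and U: "U \<in> sets sphere_measure"
  shows "(\<integral>\<^sup>+x. ennreal (norm x * p x) * indicator (dir_cone U) x \<partial>lborel) = ennreal (moment p U)"
    and "0 \<le> moment p U"
proof -
  let ?d = "DIM('a)"
  have [measurable]: "dir_cone U \<in> sets borel" by (rule dir_cone_borel[OF U])
  have [measurable]: "U \<in> sets borel" using sets_sphere_measure_borel[OF U] by simp
  have id [measurable]: "(\<lambda>v::'a. v) \<in> measurable sphere_measure borel"
    by (simp cong: measurable_cong_sets add: sets_sphere_measure measurable_restrict_space1)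
  define G where "G v = (\<integral>\<^sup>+r. ennreal (indicator {0..} r *\<^sub>R (r ^ ?d * p (r *\<^sub>R v))) \<partial>lborel)" for v :: 'a
  define h where "h v = (LINT r:{0..}|lborel. r ^ ?d * p (r *\<^sub>R v))" for v :: 'a
  define L where "L = (\<integral>\<^sup>+x. ennreal (norm x * p x) * indicator (dir_cone U) x \<partial>lborel)"
  have "L \<le> (\<integral>\<^sup>+x. ennreal (norm x * p x) \<partial>lborel)"
    unfolding L_def by (intro nn_integral_mono) (auto simp: indicator_def)
  then have Lfin: "L < \<infinity>" using fin by (rule le_less_trans)
  have [measurable]: "G \<in> borel_measurable sphere_measure"
    unfolding G_def by (rule measurable_compose[OF id]) measurable
  have [measurable]: "h \<in> borel_measurable sphere_measure"
    unfolding h_def set_lebesgue_integral_def by (rule measurable_compose[OF id]) measurable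
  \<comment> \<open>Valid also where \<open>G v\<close> is infinite: both sides are then
    \<open>0\<close>.\<close>
  have hG: "h v = enn2real (G v)" for v
    unfolding h_def G_def set_lebesgue_integral_def
    by (rule integral_eq_nn_integral) (auto simp: indicator_def p0)
  have h0: "0 \<le> h v" for v unfolding hG by simp
  have L: "L = (\<integral>\<^sup>+v. G v * indicator U v \<partial>sphere_measure)"
    unfolding L_def
  proof (subst nn_integral_polar[symmetric], measurable, rule nn_integral_cong)
    fix v :: 'a assume "v \<in> space sphere_measure"
    then have v: "norm v = 1" by simp
    have "(\<integral>\<^sup>+r. ennreal (r ^ (?d - 1)) * (ennreal (norm (r *\<^sub>R v) * p (r *\<^sub>R v)) * indicator (dir_cone U) (r *\<^sub>R v)) * indicator {0<..} r \<partial>lborel)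
      = (\<integral>\<^sup>+r. ennreal (indicator {0..} r *\<^sub>R (r ^ ?d * p (r *\<^sub>R v))) * indicator U v \<partial>lborel)"
    proof (rule nn_integral_cong)
      fix r :: real
      \<comment> \<open>The weight \<open>r ^ ?d\<close> of \<open>moment\<close> is the polar
        density \<open>r ^ (?d - 1)\<close> times \<open>norm (r *\<^sub>R v)\<close>.\<close>
      have "r ^ (?d - 1) * r = r ^ ?d" using power_Suc2[of r "?d - 1"] by simp
      then have "ennreal (r ^ (?d - 1)) * ennreal (norm (r *\<^sub>R v) * p (r *\<^sub>R v)) = ennreal (r ^ ?d * p (r *\<^sub>R v))" if "0 < r"
        using that v p0[of "r *\<^sub>R v"] by (subst ennreal_mult[symmetric]) (auto simp: mult.assoc[symmetric])
      moreover have "r *\<^sub>R v \<in> dir_cone U \<longleftrightarrow> v \<in> U" if "0 < r"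
        using that v by (auto simp: dir_cone_def sgn_scaleR sgn_div_norm)
      ultimately show "ennreal (r ^ (?d - 1)) * (ennreal (norm (r *\<^sub>R v) * p (r *\<^sub>R v)) * indicator (dir_cone U) (r *\<^sub>R v)) * indicator {0<..} r
        = ennreal (indicator {0..} r *\<^sub>R (r ^ ?d * p (r *\<^sub>R v))) * indicator U v"
        \<comment> \<open>At \<open>r = 0\<close> the two half-lines differ, but
          \<open>r ^ ?d\<close> vanishes there because the dimension is positive.\<close>
        by (cases "0 < r"; cases "r = 0") (auto simp: mult.assoc[symmetric] indicator_def zero_power simp del: norm_scaleR)
    qed
    also have "\<dots> = G v * indicator U v"
      unfolding G_def by (rule nn_integral_multc) measurable
    finally show "(\<integral>\<^sup>+r. ennreal (r ^ (?d - 1)) * (ennreal (norm (r *\<^sub>R v) * p (r *\<^sub>R v)) * indicator (dir_cone U) (r *\<^sub>R v)) * indicator {0<..} r \<partial>lborel)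
      = G v * indicator U v" .
  qed
  have "AE v in sphere_measure. G v * indicator U v \<noteq> \<infinity>"
    by (rule nn_integral_PInf_AE) (use L Lfin U in auto)
  then have AE: "AE v in sphere_measure. ennreal (indicator U v *\<^sub>R h v) = G v * indicator U v"
    by eventually_elim (auto simp: indicator_def hG less_top split: if_splits)
  have "moment p U = enn2real (\<integral>\<^sup>+v. ennreal (indicator U v *\<^sub>R h v) \<partial>sphere_measure)"
    unfolding moment_def h_def[symmetric]
    unfolding set_lebesgue_integral_def
    by (rule integral_eq_nn_integral) (use U h0 in auto)
  also have "\<dots> = enn2real L" unfolding L using AE by (intro arg_cong[where f=enn2real] nn_integral_cong_AE)
  finally have m: "moment p U = enn2real L" .
  then show "(\<integral>\<^sup>+x. ennreal (norm x * p x) * indicator (dir_cone U) x \<partial>lborel) = ennreal (moment p U)"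
    using Lfin by (simp add: L_def[symmetric])
  show "0 \<le> moment p U" using m by simp
qed

lemma nn_integral_density_norm:
  fixes p :: "'a::euclidean_space \<Rightarrow> real"
  assumes [measurable]: "p \<in> borel_measurable borel" and p0: "\<And>x. 0 \<le> p x"
    and int: "integrable (density lebesgue (\<lambda>x. ennreal (p x))) norm"
  shows "(\<integral>\<^sup>+x. ennreal (norm x * p x) \<partial>lborel) < \<infinity>"
proof -
  have "(\<integral>\<^sup>+x. ennreal (norm x) \<partial>density lebesgue (\<lambda>x. ennreal (p x))) < \<infinity>"
    using int by (simp add: integrable_iff_bounded)
  also have "(\<integral>\<^sup>+x. ennreal (norm x) \<partial>density lebesgue (\<lambda>x. ennreal (p x)))
      = (\<integral>\<^sup>+x. ennreal (p x) * ennreal (norm x) \<partial>lebesgue)"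
    by (rule nn_integral_density) (auto intro!: measurable_completion)
  also have "\<dots> = (\<integral>\<^sup>+x. ennreal (norm x * p x) \<partial>lebesgue)"
    by (intro nn_integral_cong) (simp add: ennreal_mult p0 mult.commute)
  also have "\<dots> = (\<integral>\<^sup>+x. ennreal (norm x * p x) \<partial>lborel)"
    by (rule nn_integral_completion) 
  finally show ?thesis .
qed

text \<open>The source of all convergence: these moments dominate the gauge sums, up to the factor
  \<open>1 / \<epsilon>\<close>, and the positive parts of \<open>moment_diff\<close> in the search
  for the scaling parameter.\<close>

lemma has_sum_moment:
  fixes \<U> :: "'a::euclidean_space set set"
  assumes \<U>: "open_partition_ae \<U>"
    and p [measurable]: "p \<in> borel_measurable borel" and p0: "\<And>x. 0 \<le> p x"
    and int: "integrable (density lebesgue (\<lambda>x. ennreal (p x))) norm"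
  shows "(moment p has_sum (\<integral>x. norm x \<partial>density lebesgue (\<lambda>x. ennreal (p x)))) \<U>"
proof -
  note fin = nn_integral_density_norm[OF p p0 int]
  have "(\<integral>\<^sup>+U. ennreal (moment p U) \<partial>count_space \<U>)
      = (\<integral>\<^sup>+U. (\<integral>\<^sup>+x. ennreal (norm x * p x) * indicator (dir_cone U) x \<partial>lebesgue) \<partial>count_space \<U>)"
    using moment_eq_nn_integral(1)[OF p p0 fin] open_partition_ae_sets[OF \<U>] dir_cone_borel
    by (intro nn_integral_cong) (simp add: nn_integral_completion)
  also have "\<dots> = (\<integral>\<^sup>+x. ennreal (norm x * p x) \<partial>lebesgue)"
    by (rule nn_integral_open_partition[OF \<U>, symmetric]) (auto intro!: measurable_completion)
  also have "\<dots> = (\<integral>\<^sup>+x. ennreal (p x) * ennreal (norm x) \<partial>lebesgue)"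
    by (intro nn_integral_cong) (simp add: ennreal_mult p0 mult.commute)
  also have "\<dots> = (\<integral>\<^sup>+x. ennreal (norm x) \<partial>density lebesgue (\<lambda>x. ennreal (p x)))"
    by (rule nn_integral_density[symmetric]) (auto intro!: measurable_completion)
  also have "\<dots> = ennreal (\<integral>x. norm x \<partial>density lebesgue (\<lambda>x. ennreal (p x)))"
    by (rule nn_integral_eq_integral[OF int]) simp
  finally show ?thesis
    using moment_eq_nn_integral(2)[OF p p0 fin] open_partition_ae_sets[OF \<U>]
    by (subst (asm) nn_integral_count_space_iff_has_sum) auto
qed

lemma star_gauge_open_partition:
  fixes \<U> :: "'a::euclidean_space set set"
  assumes K: "star_set K" and U: "U \<in> \<U>" "x \<in> dir_cone U"
    and \<rho>: "\<And>U u. U \<in> \<U> \<Longrightarrow> u \<in> U \<Longrightarrow> radial K u = ereal (\<rho> U)" "\<And>U. U \<in> \<U> \<Longrightarrow> 0 < \<rho> U"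
  shows "star_gauge K x = norm x / \<rho> U"
  using U by (intro star_gauge_eq[OF K] \<rho>) (auto simp: dir_cone_def)

text \<open>On each of the countably many cones the gauge is a multiple of the norm. Nothing is
  known about it elsewhere, but every subset of that null set is Lebesgue measurable.\<close>

lemma borel_measurable_star_gauge:
  fixes \<U> :: "'a::euclidean_space set set"
  assumes \<U>: "open_partition_ae \<U>" and K: "star_set K"
    and \<rho>: "\<And>U u. U \<in> \<U> \<Longrightarrow> u \<in> U \<Longrightarrow> radial K u = ereal (\<rho> U)" "\<And>U. U \<in> \<U> \<Longrightarrow> 0 < \<rho> U"
  shows "star_gauge K \<in> borel_measurable lebesgue"
proof -
  let ?N = "- (\<Union>U\<in>\<U>. dir_cone U)"
  note cnt = open_partition_ae_countable[OF \<U>]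
  have meas: "dir_cone U \<in> sets lebesgue" if "U \<in> \<U>" for U
    using dir_cone_borel[OF open_partition_ae_sets[OF \<U> that]] by simp
  obtain N where N: "negligible N" "{x. x \<notin> (\<Union>U\<in>\<U>. dir_cone U)} \<subseteq> N"
    using open_partition_ae_AE[OF \<U>] unfolding eventually_ae_filter_negligible by blast
  from N(1) have N: "negligible ?N" by (rule negligible_subset) (use N(2) in blast)
  show ?thesis
  proof (rule measurable_piecewise_restrict[where C = "insert ?N (dir_cone ` \<U>)"])
    show "countable (insert ?N (dir_cone ` \<U>))" using cnt by simp
    show "space lebesgue \<subseteq> \<Union> (insert ?N (dir_cone ` \<U>))" by auto
    fix C assume C: "C \<in> insert ?N (dir_cone ` \<U>)"
    then show "C \<inter> space lebesgue \<in> sets lebesgue" using meas N negligible_imp_sets by auto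
    show "star_gauge K \<in> borel_measurable (restrict_space lebesgue C)"
    proof (cases "C = ?N")
      case True
      show ?thesis
      proof (rule measurableI)
        fix A :: "real set"
        have "star_gauge K -` A \<inter> ?N \<in> sets lebesgue"
          using negligible_subset[OF N] by (intro negligible_imp_sets) auto
        then show "star_gauge K -` A \<inter> space (restrict_space lebesgue C) \<in> sets (restrict_space lebesgue C)"
          using True by (auto simp: space_restrict_space sets_restrict_space)
      qed auto
    next
      case False
      then obtain U where U: "U \<in> \<U>" "C = dir_cone U" using C by auto
      have "(\<lambda>x. norm x / \<rho> U) \<in> borel_measurable (restrict_space lebesgue C)"
        by (intro measurable_restrict_space1 measurable_completion) simp
      then show ?thesis
        by (rule measurable_cong[THEN iffD1, rotated])
           (use U star_gauge_open_partition[OF K _ _ \<rho>] in \<open>auto simp: space_restrict_space\<close>)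
    qed
  qed
qed

text \<open>Summability comes first, by comparison with \<open>moment p U / \<epsilon>\<close>: a
  Bochner integral can be read off the nonnegative one only when the latter is finite.\<close>

lemma has_sum_moment_star_gauge:
  fixes \<U> :: "'a::euclidean_space set set"
  assumes \<U>: "open_partition_ae \<U>" and K: "star_set K"
    and \<rho>: "\<And>U u. U \<in> \<U> \<Longrightarrow> u \<in> U \<Longrightarrow> radial K u = ereal (\<rho> U)" "\<And>U. U \<in> \<U> \<Longrightarrow> \<epsilon> \<le> \<rho> U"
    and \<epsilon>: "0 < \<epsilon>"
    and p [measurable]: "p \<in> borel_measurable borel" and p0: "\<And>x. 0 \<le> p x"
    and int: "integrable (density lebesgue (\<lambda>x. ennreal (p x))) norm"
  shows "((\<lambda>U. moment p U / \<rho> U) has_sum (\<integral>x. star_gauge K x \<partial>density lebesgue (\<lambda>x. ennreal (p x)))) \<U>"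
proof -
  let ?P = "density lebesgue (\<lambda>x. ennreal (p x))"
  note fin = nn_integral_density_norm[OF p p0 int]
  note mom = moment_eq_nn_integral[OF p p0 fin]
  have \<rho>0: "0 < \<rho> U" if "U \<in> \<U>" for U using \<rho>(2)[OF that] \<epsilon> by simp
  note gauge = star_gauge_open_partition[OF K _ _ \<rho>(1) \<rho>0]
  have gm [measurable]: "star_gauge K \<in> borel_measurable lebesgue"
    by (rule borel_measurable_star_gauge[OF \<U> K \<rho>(1) \<rho>0])
  have pm: "(\<lambda>x. ennreal (p x)) \<in> borel_measurable lebesgue"
    by (intro measurable_completion) simp
  \<comment> \<open>Only almost everywhere: outside the cones the set in \<open>star_gauge\<close>
    may be empty under the present assumptions, and its real infimum is then unspecified.\<close>
  have nonneg: "AE x in ?P. 0 \<le> star_gauge K x"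
  proof -
    have "AE x in lebesgue. 0 < ennreal (p x) \<longrightarrow> 0 \<le> star_gauge K x"
      using open_partition_ae_AE[OF \<U>]
    proof eventually_elim
      case (elim x)
      then obtain U where "U \<in> \<U>" "x \<in> dir_cone U" by blast
      then show ?case using gauge \<rho>0 by (simp add: less_imp_le)
    qed
    then show ?thesis using pm by (simp add: AE_density)
  qed
  obtain S where S: "((\<lambda>U. moment p U / \<rho> U) has_sum S) \<U>"
  proof -
    have "(\<lambda>U. moment p U * (1 / \<epsilon>)) summable_on \<U>"
      using has_sum_moment[OF \<U> p p0 int] by (intro summable_on_cmult_left) (auto simp: summable_on_def)
    then have "(\<lambda>U. moment p U / \<rho> U) summable_on \<U>"
      by (rule summable_on_comparison_test)
         (use mom(2) open_partition_ae_sets[OF \<U>] \<rho>(2) \<rho>0 \<epsilon> in \<open>auto intro!: divide_left_mono simp: less_imp_le\<close>)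
    then show ?thesis using that by (auto simp: summable_on_def)
  qed
  have S0: "0 \<le> S"
    using S by (rule has_sum_nonneg) (use mom(2) open_partition_ae_sets[OF \<U>] \<rho>0 in \<open>auto simp: less_imp_le\<close>)
  have "(\<integral>\<^sup>+x. ennreal (star_gauge K x) \<partial>?P) = (\<integral>\<^sup>+x. ennreal (p x) * ennreal (star_gauge K x) \<partial>lebesgue)"
    by (rule nn_integral_density) (auto intro!: measurable_completion)
  also have "\<dots> = (\<integral>\<^sup>+U. (\<integral>\<^sup>+x. ennreal (p x) * ennreal (star_gauge K x) * indicator (dir_cone U) x \<partial>lebesgue) \<partial>count_space \<U>)"
    by (rule nn_integral_open_partition[OF \<U>]) (intro borel_measurable_times_ennreal pm measurable_compose[OF gm measurable_ennreal])
  also have "\<dots> = (\<integral>\<^sup>+U. ennreal (moment p U / \<rho> U) \<partial>count_space \<U>)"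
  proof (rule nn_integral_cong)
    fix U assume "U \<in> space (count_space \<U>)"
    then have U: "U \<in> \<U>" by simp
    note Us = open_partition_ae_sets[OF \<U> U]
    have [measurable]: "dir_cone U \<in> sets borel" by (rule dir_cone_borel[OF Us])
    have "(\<integral>\<^sup>+x. ennreal (p x) * ennreal (star_gauge K x) * indicator (dir_cone U) x \<partial>lebesgue)
      = (\<integral>\<^sup>+x. ennreal (1 / \<rho> U) * (ennreal (norm x * p x) * indicator (dir_cone U) x) \<partial>lebesgue)"
    proof (rule nn_integral_cong)
      fix x :: 'a
      show "ennreal (p x) * ennreal (star_gauge K x) * indicator (dir_cone U) x
        = ennreal (1 / \<rho> U) * (ennreal (norm x * p x) * indicator (dir_cone U) x)"
      proof (cases "x \<in> dir_cone U")
        case True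
        have "p x * (norm x / \<rho> U) = 1 / \<rho> U * (norm x * p x)" by simp
        then have "ennreal (p x) * ennreal (norm x / \<rho> U) = ennreal (1 / \<rho> U) * ennreal (norm x * p x)"
          using p0[of x] \<rho>0[OF U] by (metis ennreal_mult norm_ge_zero mult_nonneg_nonneg divide_nonneg_pos zero_le_one)
        then show ?thesis using True gauge[OF U True] by simp
      qed simp
    qed
    also have "\<dots> = (\<integral>\<^sup>+x. ennreal (1 / \<rho> U) * (ennreal (norm x * p x) * indicator (dir_cone U) x) \<partial>lborel)"
      by (rule nn_integral_completion)
    also have "\<dots> = ennreal (1 / \<rho> U) * ennreal (moment p U)"
      unfolding mom(1)[OF Us, symmetric] by (rule nn_integral_cmult) measurable
    also have "\<dots> = ennreal (moment p U / \<rho> U)"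
      using mom(2)[OF Us] \<rho>0[OF U] by (simp add: ennreal_mult[symmetric])
    finally show "(\<integral>\<^sup>+x. ennreal (p x) * ennreal (star_gauge K x) * indicator (dir_cone U) x \<partial>lebesgue)
      = ennreal (moment p U / \<rho> U)" .
  qed
  also have "\<dots> = ennreal S"
    using S0 S mom(2) open_partition_ae_sets[OF \<U>] \<rho>0
    by (subst nn_integral_count_space_iff_has_sum) (auto simp: less_imp_le)
  finally have "(\<integral>\<^sup>+x. ennreal (star_gauge K x) \<partial>?P) = ennreal S" .
  then have "(\<integral>x. star_gauge K x \<partial>?P) = S"
    using S0 nonneg by (subst integral_eq_nn_integral) auto
  then show ?thesis using S by simp
qed

subsection \<open>The one-dimensional problem on a block\<close>

text \<open>Splitting off one factor \<open>1 + x\<close> before applying the weak inequality leaves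
  a spare \<open>n * x\<^sup>2\<close>, which gives strictness.\<close>

lemma Bernoulli_strict:
  fixes x :: real
  assumes "-1 < x" "x \<noteq> 0" "0 < n"
  shows "1 + real (n + 1) * x < (1 + x) ^ (n + 1)"
proof -
  have "1 + real (n + 1) * x < 1 + real (n + 1) * x + real n * x\<^sup>2" using assms by simp
  also have "\<dots> = (1 + x) * (1 + real n * x)" by (simp add: algebra_simps power2_eq_square)
  also have "\<dots> \<le> (1 + x) * (1 + x) ^ n"
    using assms by (intro mult_left_mono Bernoulli_inequality) auto
  finally show ?thesis by simp
qed

text \<open>As a function of \<open>r\<close> the right side is stationary at \<open>r0\<close> and
  equals the left side there; this is the strict Bernoulli inequality at
  \<open>x = r / r0 - 1\<close>, multiplied by \<open>r0 ^ (n + 1) / r\<close>.\<close>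

lemma power_inverse_less:
  fixes r r0 :: real
  assumes "0 < n" "0 < r" "0 < r0" "r \<noteq> r0"
  shows "real (n + 1) * r0 ^ n < real n * r0 ^ (n + 1) / r + r ^ n"
proof -
  have "1 + real (n + 1) * (r / r0 - 1) < (1 + (r / r0 - 1)) ^ (n + 1)"
    using assms by (intro Bernoulli_strict) (auto simp: field_simps)
  then have "1 + real (n + 1) * (r / r0 - 1) < r ^ (n + 1) / r0 ^ (n + 1)" by (simp add: power_divide)
  then have "(r0 ^ (n + 1) / r) * (1 + real (n + 1) * (r / r0 - 1)) < (r0 ^ (n + 1) / r) * (r ^ (n + 1) / r0 ^ (n + 1))"
    using assms by (intro mult_strict_left_mono) auto
  also have "\<dots> = r ^ n" using assms by simp
  also have "(r0 ^ (n + 1) / r) * (1 + real (n + 1) * (r / r0 - 1)) = real (n + 1) * r0 ^ n - real n * r0 ^ (n + 1) / r"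
    using assms by (simp add: field_simps)
  finally show ?thesis by simp
qed

text \<open>Removing the case split exhibits a continuous function of \<open>1 / lam\<close>. The
  inner \<open>max 0\<close> keeps the base of \<open>powr\<close> nonnegative; a negative moment
  falls under the first case anyway.\<close>

lemma opt_radius_eq_max:
  fixes p q :: "'a::euclidean_space \<Rightarrow> real"
  assumes "0 < \<epsilon>" "0 < lam" "0 < area U"
  shows "opt_radius \<epsilon> p q lam U =
    max \<epsilon> ((max 0 (moment_diff p q U) / (real DIM('a) * area U * lam)) powr (1 / (real DIM('a) + 1)))"
proof -
  let ?d = "DIM('a)" and ?\<sigma> = "moment_diff p q U"
  let ?c = "real ?d * area U * lam"
  have c: "0 < ?c" using assms by simp
  have eps: "(\<epsilon> ^ (?d + 1)) powr (1 / (real ?d + 1)) = \<epsilon>"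
  proof -
    have "\<epsilon> ^ (?d + 1) = \<epsilon> powr (real ?d + 1)"
      using assms powr_realpow[of \<epsilon> "?d + 1"] by (simp add: add.commute)
    then show ?thesis using assms by (simp add: powr_powr)
  qed
  show ?thesis
  proof (cases "?\<sigma> < \<epsilon> ^ (?d + 1) * ?d * area U * lam")
    case True
    then have "?\<sigma> < \<epsilon> ^ (?d + 1) * ?c" by (simp only: mult.assoc)
    then have "max 0 ?\<sigma> / ?c \<le> \<epsilon> ^ (?d + 1)"
      using c assms by (simp add: pos_divide_le_eq max_def less_imp_le del: power_Suc)
    then have "(max 0 ?\<sigma> / ?c) powr (1 / (real ?d + 1)) \<le> (\<epsilon> ^ (?d + 1)) powr (1 / (real ?d + 1))"
      using c by (intro powr_mono2) auto
    then show ?thesis using True unfolding eps opt_radius_def by simp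
  next
    case False
    then have ge: "\<epsilon> ^ (?d + 1) * ?c \<le> ?\<sigma>" by (simp only: mult.assoc not_less)
    moreover have "0 < \<epsilon> ^ (?d + 1) * ?c" using c assms by simp
    ultimately have pos: "0 < ?\<sigma>" by linarith
    have "\<epsilon> ^ (?d + 1) \<le> ?\<sigma> / ?c"
      using ge c by (simp only: pos_le_divide_eq)
    then have "(\<epsilon> ^ (?d + 1)) powr (1 / (real ?d + 1)) \<le> (?\<sigma> / ?c) powr (1 / (real ?d + 1))"
      using assms by (intro powr_mono2) auto
    then show ?thesis using False pos unfolding eps opt_radius_def by simp
  qed
qed

lemma opt_radius_ge:
  fixes p q :: "'a::euclidean_space \<Rightarrow> real"
  shows "0 < \<epsilon> \<Longrightarrow> 0 < lam \<Longrightarrow> 0 < area U \<Longrightarrow> \<epsilon> \<le> opt_radius \<epsilon> p q lam U"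
  by (simp add: opt_radius_eq_max)

lemma opt_radius_less:
  fixes p q :: "'a::euclidean_space \<Rightarrow> real"
  assumes "0 < \<epsilon>" "0 < lam" "0 < area U" "\<epsilon> \<le> r" "r \<noteq> opt_radius \<epsilon> p q lam U"
  defines "r0 \<equiv> opt_radius \<epsilon> p q lam U"
  shows "moment_diff p q U / r0 + lam * (area U * r0 ^ DIM('a)) < moment_diff p q U / r + lam * (area U * r ^ DIM('a))"
proof -
  let ?d = "DIM('a)" and ?\<sigma> = "moment_diff p q U"
  let ?a = "lam * area U"
  have a: "0 < ?a" using assms by simp
  have r: "0 < r" using assms by simp
  have "\<epsilon> \<le> r0" unfolding r0_def using assms(1-3) by (rule opt_radius_ge)
  then have r0: "0 < r0" using assms by simp
  \<comment> \<open>The right side has the critical moment \<open>?a * ?d * r0 ^ (?d + 1)\<close>,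
    for which \<open>r0\<close> is the unconstrained minimiser, in place of
    \<open>?\<sigma>\<close>. Above the threshold the two agree; below it \<open>?\<sigma>\<close>
    is smaller, and \<open>1 / r0 - 1 / r\<close> is nonnegative because
    \<open>r0 = \<epsilon> \<le> r\<close>.\<close>
  have "?\<sigma> / r0 - ?\<sigma> / r \<le> ?a * ?d * r0 ^ (?d + 1) / r0 - ?a * ?d * r0 ^ (?d + 1) / r"
  proof (cases "?\<sigma> < \<epsilon> ^ (?d + 1) * real ?d * area U * lam")
    case True
    then have e: "r0 = \<epsilon>" by (simp add: r0_def opt_radius_def)
    have "0 \<le> 1 / r0 - 1 / r" using assms(4) r0 e by (simp add: frac_le)
    moreover have "?\<sigma> \<le> ?a * ?d * r0 ^ (?d + 1)" using True by (simp add: e mult_ac)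
    ultimately have "?\<sigma> * (1 / r0 - 1 / r) \<le> (?a * ?d * r0 ^ (?d + 1)) * (1 / r0 - 1 / r)"
      by (rule mult_right_mono[rotated])
    then show ?thesis by (simp only: right_diff_distrib mult_1_right times_divide_eq_right)
  next
    case False
    let ?c = "real ?d * area U * lam"
    have c: "0 < ?c" using assms by simp
    have "0 < \<epsilon> ^ (?d + 1) * real ?d * area U * lam" using assms by simp
    then have pos: "0 < ?\<sigma> / ?c" using False c by (intro divide_pos_pos) linarith+
    have "r0 = (?\<sigma> / ?c) powr (1 / (real ?d + 1))" using False by (simp add: r0_def opt_radius_def)
    moreover have "(y powr (1 / (real ?d + 1))) powr (real (?d + 1)) = y" if "0 < y" for y :: real
      using that by (simp add: powr_powr add.commute)
    ultimately have "r0 powr (real (?d + 1)) = ?\<sigma> / ?c" using pos by simp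
    then have "r0 ^ (?d + 1) = ?\<sigma> / ?c" using r0 powr_realpow[of r0 "?d + 1"] by simp
    then have "?\<sigma> = ?c * r0 ^ (?d + 1)" using assms(2,3) by simp
    then have "?\<sigma> = ?a * ?d * r0 ^ (?d + 1)" by (simp only: mult_ac)
    then show ?thesis by simp
  qed
  also have "\<dots> = ?a * (real ?d * r0 ^ ?d - real ?d * r0 ^ (?d + 1) / r)"
    using r0 by (simp add: field_simps)
  also have "\<dots> < ?a * (r ^ ?d - r0 ^ ?d)"
    using power_inverse_less[of ?d r r0] r r0 assms(5) a
    by (intro mult_strict_left_mono) (auto simp: r0_def algebra_simps)
  finally show ?thesis by (simp add: algebra_simps)
qed

subsection \<open>Star sets and their radial functions\<close>

text \<open>The value \<open>c\<close> is left general to serve twice: \<open>c = DIM('a)\<close>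
  expresses the volume constraint, and a smaller \<open>c\<close> sums the areas through the ball of
  radius \<epsilon>.\<close>

lemma measure_star_set_eq_iff:
  fixes \<U> :: "'a::euclidean_space set set"
  assumes \<U>: "open_partition_ae \<U>" and K: "star_set K"
    and \<rho>: "\<And>U u. U \<in> \<U> \<Longrightarrow> u \<in> U \<Longrightarrow> radial K u = ereal (\<rho> U)" "\<And>U. U \<in> \<U> \<Longrightarrow> 0 < \<rho> U"
    and c: "0 < c"
  shows "measure lebesgue K = c / DIM('a) \<longleftrightarrow> ((\<lambda>U. area U * \<rho> U ^ DIM('a)) has_sum c) \<U>"
proof -
  let ?d = "DIM('a)"
  have em: "emeasure lebesgue K = (\<integral>\<^sup>+U. ennreal (area U * \<rho> U ^ ?d / ?d) \<partial>count_space \<U>)"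
    by (rule emeasure_star_set(2)[OF \<U> K \<rho>])
  have "measure lebesgue K = c / ?d \<longleftrightarrow> emeasure lebesgue K = ennreal (c / ?d)"
  proof
    assume m: "measure lebesgue K = c / ?d"
    \<comment> \<open>An infinite \<open>emeasure\<close> would give \<open>measure\<close> the
      value \<open>0\<close>, but \<open>c\<close> is positive.\<close>
    then have "emeasure lebesgue K \<noteq> \<infinity>" using c by (auto simp: measure_def)
    then show "emeasure lebesgue K = ennreal (c / ?d)" using m emeasure_eq_ennreal_measure[of lebesgue K] by simp
  next
    assume "emeasure lebesgue K = ennreal (c / ?d)"
    then show "measure lebesgue K = c / ?d" using c by (simp add: measure_def)
  qed
  also have "\<dots> \<longleftrightarrow> ((\<lambda>U. area U * \<rho> U ^ ?d / ?d) has_sum (c / ?d)) \<U>"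
    unfolding em using c \<rho>(2) by (intro nn_integral_count_space_iff_has_sum) (auto simp: area_nonneg less_imp_le)
  also have "\<dots> \<longleftrightarrow> ((\<lambda>U. area U * \<rho> U ^ ?d) has_sum c) \<U>"
    using has_sum_cmult_right[of "\<lambda>U. area U * \<rho> U ^ ?d / ?d" \<U> "c / ?d" "real ?d"]
      has_sum_cmult_right[of "\<lambda>U. area U * \<rho> U ^ ?d" \<U> c "1 / real ?d"] by auto
  finally show ?thesis .
qed

text \<open>An infinite radius over a block would put its whole cone into \<open>K\<close>; the
  block has positive area, so the volume would exceed \<open>1\<close>.\<close>

lemma radial_finite:
  fixes \<U> :: "'a::euclidean_space set set"
  assumes \<U>: "open_partition_ae \<U>" and \<epsilon>: "0 < \<epsilon>" and K: "feasible \<epsilon> \<U> K"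
  obtains \<rho> where "\<And>U u. U \<in> \<U> \<Longrightarrow> u \<in> U \<Longrightarrow> radial K u = ereal (\<rho> U)" "\<And>U. U \<in> \<U> \<Longrightarrow> \<epsilon> \<le> \<rho> U"
proof -
  have m: "measure lebesgue K = 1" and cball: "cball 0 \<epsilon> \<subseteq> K" and star: "star_set K"
    and const: "\<And>U. U \<in> \<U> \<Longrightarrow> radial K constant_on U"
    using K by (auto simp: feasible_def piecewise_constant_def)
  \<comment> \<open>\<open>measure\<close> is \<open>0\<close> on sets of infinite measure and on
    non-measurable sets, so the value \<open>1\<close> decides both finiteness and
    measurability.\<close>
  have em: "emeasure lebesgue K = 1"
    using m emeasure_eq_ennreal_measure[of lebesgue K] by (auto simp: measure_def)
  have Ks: "K \<in> sets lebesgue" using em emeasure_notin_sets[of K lebesgue] by auto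
  have "\<exists>r. (\<forall>u\<in>U. radial K u = ereal r) \<and> \<epsilon> \<le> r" if U: "U \<in> \<U>" for U
  proof -
    note Us = open_partition_ae_sets[OF \<U> U]
    obtain c where c: "\<And>u. u \<in> U \<Longrightarrow> radial K u = c" using const[OF U] by (auto simp: constant_on_def)
    have "U \<noteq> {}" using \<U> U by (simp add: open_partition_ae_def)
    then obtain u where u: "u \<in> U" by blast
    have "norm u = 1" using u sets_sphere_measure_borel[OF Us] by auto
    then have ge: "ereal \<epsilon> \<le> c" using radial_ge[OF cball, of u] \<epsilon> c[OF u] by simp
    have "c \<noteq> \<infinity>"
    proof
      assume inf: "c = \<infinity>"
      have sub: "dir_cone U \<subseteq> K"
      proof
        fix x assume "x \<in> dir_cone U"
        then have x: "x \<noteq> 0" "sgn x \<in> U" by (auto simp: dir_cone_def)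
        then have "norm x *\<^sub>R sgn x \<in> K" using c inf by (intro radial_mem[OF star]) auto
        then show "x \<in> K" using x by (simp add: sgn_div_norm)
      qed
      \<comment> \<open>\<open>b \<ge> 1\<close> gives \<open>b ^ DIM('a) \<ge> b\<close>, and the
        second bound then makes the truncated cone have volume at least \<open>2\<close>.\<close>
      define b where "b = max 1 (2 * DIM('a) / area U)"
      have w: "0 < area U" by (rule open_partition_ae_area_pos[OF \<U> U])
      have b: "1 \<le> b" "2 * DIM('a) / area U \<le> b" by (auto simp: b_def)
      have "2 * DIM('a) \<le> area U * b" using b w by (simp add: field_simps)
      also have "\<dots> \<le> area U * b ^ DIM('a)" using b w self_le_power[of b "DIM('a)"] by simp
      finally have "1 < area U * b ^ DIM('a) / DIM('a)" by (simp add: field_simps) (use DIM_positive[where 'a='a] in linarith)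
      then have "ennreal 1 < ennreal (area U * b ^ DIM('a) / DIM('a))" by (intro ennreal_lessI) auto
      also have "\<dots> = emeasure lborel (dir_cone U \<inter> ball 0 b)"
        using emeasure_dir_cone_ball[OF Us, of b] b by simp
      also have "\<dots> = emeasure lebesgue (dir_cone U \<inter> ball 0 b)"
        using dir_cone_borel[OF Us] by simp
      also have "\<dots> \<le> emeasure lebesgue K" using sub Ks by (intro emeasure_mono) auto
      finally show False using em by simp
    qed
    then obtain r where "c = ereal r" using ge by (cases c) auto
    then show ?thesis using c ge by auto
  qed
  then obtain \<rho> where "\<And>U. U \<in> \<U> \<Longrightarrow> (\<forall>u\<in>U. radial K u = ereal (\<rho> U)) \<and> \<epsilon> \<le> \<rho> U" by metis
  then show ?thesis using that by blast
qed

lemma star_set_with_radial: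
  fixes \<U> :: "'a::euclidean_space set set"
  assumes \<U>: "open_partition_ae \<U>" and \<epsilon>: "0 < \<epsilon>" and \<rho>: "\<And>U. U \<in> \<U> \<Longrightarrow> \<epsilon> \<le> \<rho> U"
  obtains K where "star_set K" "cball 0 \<epsilon> \<subseteq> K" "\<And>U u. U \<in> \<U> \<Longrightarrow> u \<in> U \<Longrightarrow> radial K u = ereal (\<rho> U)"
proof -
  \<comment> \<open>The ball serves the origin and the directions outside all blocks; over a block
    it adds nothing, as \<open>\<epsilon> \<le> \<rho> U\<close>.\<close>
  define K where "K = cball 0 \<epsilon> \<union> {x. \<exists>U\<in>\<U>. x \<in> dir_cone U \<and> norm x \<le> \<rho> U}"
  show ?thesis
  proof
    show "cball 0 \<epsilon> \<subseteq> K" by (auto simp: K_def)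
    show "star_set K"
      unfolding star_set_def
    proof (intro ballI subsetI)
      fix y z assume y: "y \<in> K" and "z \<in> closed_segment 0 y"
      then obtain t where t: "0 \<le> t" "t \<le> 1" "z = t *\<^sub>R y" by (auto simp: closed_segment_def)
      have nz: "norm z \<le> norm y" using t by (simp add: mult_left_le_one_le)
      show "z \<in> K"
      proof (cases "y \<in> cball 0 \<epsilon> \<or> t = 0")
        case True
        then show ?thesis using nz t \<epsilon> by (auto simp: K_def)
      next
        case False
        then obtain U where "U \<in> \<U>" "y \<in> dir_cone U" "norm y \<le> \<rho> U" using y by (auto simp: K_def)
        moreover have "z \<in> dir_cone U" using False t calculation by (simp add: scaleR_mem_dir_cone_iff)
        ultimately show ?thesis using nz by (auto simp: K_def)
      qed
    qed
    fix U u assume U: "U \<in> \<U>" "u \<in> U"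
    have nu: "norm u = 1" using U open_partition_ae_sets[OF \<U> U(1)] sets_sphere_measure_borel by fastforce
    have cone: "t *\<^sub>R u \<in> dir_cone V \<longleftrightarrow> V = U" if "V \<in> \<U>" "0 < t" for V t
    proof -
      have "t *\<^sub>R u \<in> dir_cone V \<longleftrightarrow> u \<in> V" using nu that by (auto simp: dir_cone_def sgn_scaleR sgn_div_norm)
      then show ?thesis using \<U> U that(1) by (auto simp: open_partition_ae_def disjoint_def)
    qed
    have "{t. 0 \<le> t \<and> t *\<^sub>R u \<in> K} = {0..\<rho> U}"
    proof (intro equalityI subsetI)
      fix t assume t: "t \<in> {t. 0 \<le> t \<and> t *\<^sub>R u \<in> K}"
      show "t \<in> {0..\<rho> U}"
      proof (cases "t = 0")
        case True
        then show ?thesis using \<rho>[OF U(1)] \<epsilon> by simp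
      next
        case False
        then show ?thesis using t \<rho>[OF U(1)] nu cone by (auto simp: K_def)
      qed
    next
      fix t assume t: "t \<in> {0..\<rho> U}"
      show "t \<in> {t. 0 \<le> t \<and> t *\<^sub>R u \<in> K}"
        using t \<epsilon> nu cone[OF U(1), of t] U(1) by (cases "t = 0") (auto simp: K_def)
    qed
    then have "radial K u = (SUP t\<in>{0..\<rho> U}. ereal t)" by (simp add: radial_def)
    also have "\<dots> = ereal (\<rho> U)"
      using \<rho>[OF U(1)] \<epsilon> by (intro antisym SUP_least SUP_upper) auto
    finally show "radial K u = ereal (\<rho> U)" .
  qed
qed

subsection \<open>Optimality and the scaling parameter\<close>

lemma has_sum_diff:
  fixes f g :: "'a \<Rightarrow> 'b::topological_ab_group_add"
  assumes "(f has_sum a) A" "(g has_sum b) A"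
  shows "((\<lambda>x. f x - g x) has_sum (a - b)) A"
  using has_sum_add[OF assms(1), of "\<lambda>x. - g x" "- b"] assms(2) by (simp add: has_sum_uminus)

lemma has_sum_objective:
  fixes \<U> :: "'a::euclidean_space set set" and p q :: "'a \<Rightarrow> real"
  assumes \<U>: "open_partition_ae \<U>" and K: "star_set K"
    and \<rho>: "\<And>U u. U \<in> \<U> \<Longrightarrow> u \<in> U \<Longrightarrow> radial K u = ereal (\<rho> U)" "\<And>U. U \<in> \<U> \<Longrightarrow> \<epsilon> \<le> \<rho> U"
    and \<epsilon>: "0 < \<epsilon>"
    and p: "p \<in> borel_measurable borel" "\<And>x. 0 \<le> p x" "integrable (density lebesgue (\<lambda>x. ennreal (p x))) norm"
    and q: "q \<in> borel_measurable borel" "\<And>x. 0 \<le> q x" "integrable (density lebesgue (\<lambda>x. ennreal (q x))) norm"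
  shows "((\<lambda>U. moment_diff p q U / \<rho> U) has_sum
    objective (density lebesgue (\<lambda>x. ennreal (p x))) (density lebesgue (\<lambda>x. ennreal (q x))) K) \<U>"
proof -
  have "((\<lambda>U. moment p U / \<rho> U - moment q U / \<rho> U) has_sum
    objective (density lebesgue (\<lambda>x. ennreal (p x))) (density lebesgue (\<lambda>x. ennreal (q x))) K) \<U>"
    unfolding objective_def
    by (intro has_sum_diff has_sum_moment_star_gauge[where \<rho> = \<rho>, OF \<U> K \<rho> \<epsilon>] p q)
  then show ?thesis by (simp add: moment_diff_def diff_divide_distrib)
qed

text \<open>Minimisers form a class: boundary points and directions outside the blocks affect
  neither volume nor objective, so \<open>optimal\<close> fixes the radial function on the blocks
  only.\<close>

lemma argmin_characterisation:
  fixes \<U> :: "'a::euclidean_space set set" and p q :: "'a \<Rightarrow> real"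
  assumes \<epsilon>: "0 < \<epsilon>" and \<U>: "open_partition_ae \<U>"
    and p: "p \<in> borel_measurable borel" "\<And>x. 0 \<le> p x" "integrable (density lebesgue (\<lambda>x. ennreal (p x))) norm"
    and q: "q \<in> borel_measurable borel" "\<And>x. 0 \<le> q x" "integrable (density lebesgue (\<lambda>x. ennreal (q x))) norm"
    and lam: "normalizing \<epsilon> \<U> p q lam"
  defines "P \<equiv> density lebesgue (\<lambda>x. ennreal (p x))" and "Q \<equiv> density lebesgue (\<lambda>x. ennreal (q x))"
  defines "optimal \<equiv> \<lambda>K. star_set K \<and> cball 0 \<epsilon> \<subseteq> K \<and>
    (\<forall>U\<in>\<U>. \<forall>u\<in>U. radial K u = ereal (opt_radius \<epsilon> p q lam U))"
  shows "\<exists>K. is_arg_min (objective P Q) (feasible \<epsilon> \<U>) K"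
    and "is_arg_min (objective P Q) (feasible \<epsilon> \<U>) K \<longleftrightarrow> optimal K"
proof -
  let ?d = "DIM('a)" and ?R = "opt_radius \<epsilon> p q lam"
  let ?L = "\<lambda>\<rho> U. moment_diff p q U / \<rho> U + lam * (area U * \<rho> U ^ ?d)"
  have lam0: "0 < lam" and norm: "(\<Sum>\<^sub>\<infinity>U\<in>\<U>. area U * ?R U ^ ?d) = ?d"
    using lam by (auto simp: normalizing_def field_simps)
  \<comment> \<open>A divergent family would have \<open>infsum\<close> equal to \<open>0\<close>,
    not to the positive dimension.\<close>
  have "(\<lambda>U. area U * ?R U ^ ?d) summable_on \<U>"
  proof (rule ccontr)
    assume "\<not> ?thesis"
    then show False using norm infsum_not_exists[of "\<lambda>U. area U * ?R U ^ ?d" \<U>] by simp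
  qed
  then have R_sum: "((\<lambda>U. area U * ?R U ^ ?d) has_sum ?d) \<U>" using norm has_sum_infsum by metis
  have R_ge: "\<epsilon> \<le> ?R U" if "U \<in> \<U>" for U
    by (rule opt_radius_ge[OF \<epsilon> lam0 open_partition_ae_area_pos[OF \<U> that]])
  have pos: "0 < \<rho> U" if "\<And>U. U \<in> \<U> \<Longrightarrow> \<epsilon> \<le> \<rho> U" "U \<in> \<U>" for \<rho> U
    using that \<epsilon> by (meson less_le_trans)
  have vol: "measure lebesgue K = 1 \<longleftrightarrow> ((\<lambda>U. area U * \<rho> U ^ ?d) has_sum ?d) \<U>"
    if "star_set K" "\<And>U u. U \<in> \<U> \<Longrightarrow> u \<in> U \<Longrightarrow> radial K u = ereal (\<rho> U)" "\<And>U. U \<in> \<U> \<Longrightarrow> \<epsilon> \<le> \<rho> U" for K \<rho>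
    using measure_star_set_eq_iff[OF \<U> that(1,2) pos[OF that(3)], where c = "real ?d"] by simp
  have obj: "((\<lambda>U. moment_diff p q U / \<rho> U) has_sum objective P Q K) \<U>"
    if "star_set K" "\<And>U u. U \<in> \<U> \<Longrightarrow> u \<in> U \<Longrightarrow> radial K u = ereal (\<rho> U)" "\<And>U. U \<in> \<U> \<Longrightarrow> \<epsilon> \<le> \<rho> U" for K \<rho>
    unfolding P_def Q_def by (rule has_sum_objective[OF \<U> that \<epsilon> p q])
  have lagr: "(?L \<rho> has_sum objective P Q K + lam * ?d) \<U>"
    if "star_set K" "\<And>U u. U \<in> \<U> \<Longrightarrow> u \<in> U \<Longrightarrow> radial K u = ereal (\<rho> U)" "\<And>U. U \<in> \<U> \<Longrightarrow> \<epsilon> \<le> \<rho> U"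
      "measure lebesgue K = 1" for K \<rho>
    using obj[OF that(1-3)] vol[OF that(1-3)] that(4) by (intro has_sum_add has_sum_cmult_right) auto
  have less: "?L ?R U < ?L (\<lambda>_. r) U" if "U \<in> \<U>" "\<epsilon> \<le> r" "r \<noteq> ?R U" for r U
    by (rule opt_radius_less[OF \<epsilon> lam0 open_partition_ae_area_pos[OF \<U> that(1)] that(2,3)])
  have opt_feasible: "feasible \<epsilon> \<U> K" if "optimal K" for K
    using that vol[of K ?R] R_ge R_sum
    by (auto simp: optimal_def feasible_def piecewise_constant_def constant_on_def)
  have opt_L: "(?L ?R has_sum objective P Q K + lam * ?d) \<U>" if "optimal K" for K
    using that opt_feasible[OF that] R_ge by (intro lagr) (auto simp: optimal_def feasible_def)
  have opt_le: "objective P Q K \<le> objective P Q K'" if "optimal K" "feasible \<epsilon> \<U> K'" for K K'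
  proof -
    obtain \<rho> where \<rho>: "\<And>U u. U \<in> \<U> \<Longrightarrow> u \<in> U \<Longrightarrow> radial K' u = ereal (\<rho> U)" "\<And>U. U \<in> \<U> \<Longrightarrow> \<epsilon> \<le> \<rho> U"
      using radial_finite[OF \<U> \<epsilon> \<open>feasible \<epsilon> \<U> K'\<close>] by blast
    have K': "star_set K'" "measure lebesgue K' = 1"
      using that by (auto simp: feasible_def piecewise_constant_def)
    have "objective P Q K + lam * ?d \<le> objective P Q K' + lam * ?d"
      using opt_L[OF that(1)] lagr[where \<rho> = \<rho>, OF K'(1) \<rho> K'(2)]
    proof (rule has_sum_mono)
      fix U assume U: "U \<in> \<U>"
      show "?L ?R U \<le> ?L \<rho> U"
        using less[OF U \<rho>(2)[OF U]] by (cases "\<rho> U = ?R U") auto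
    qed
    then show ?thesis by simp
  qed
  obtain K0 where "star_set K0" "cball 0 \<epsilon> \<subseteq> K0" "\<And>U u. U \<in> \<U> \<Longrightarrow> u \<in> U \<Longrightarrow> radial K0 u = ereal (?R U)"
    using star_set_with_radial[where \<rho> = ?R, OF \<U> \<epsilon> R_ge] by blast
  then have K0: "optimal K0" by (simp add: optimal_def)
  have opt_argmin: "is_arg_min (objective P Q) (feasible \<epsilon> \<U>) K" if "optimal K" for K
    using opt_feasible[OF that] opt_le[OF that] by (auto simp: is_arg_min_def not_less)
  show "\<exists>K. is_arg_min (objective P Q) (feasible \<epsilon> \<U>) K" using opt_argmin[OF K0] by blast
  have "optimal K" if K: "is_arg_min (objective P Q) (feasible \<epsilon> \<U>) K"
  proof -
    have fK: "feasible \<epsilon> \<U> K" and min: "objective P Q K \<le> objective P Q K0"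
      using K opt_feasible[OF K0] by (auto simp: is_arg_min_def not_less)
    obtain \<rho> where \<rho>: "\<And>U u. U \<in> \<U> \<Longrightarrow> u \<in> U \<Longrightarrow> radial K u = ereal (\<rho> U)" "\<And>U. U \<in> \<U> \<Longrightarrow> \<epsilon> \<le> \<rho> U"
      using radial_finite[OF \<U> \<epsilon> fK] by blast
    have K': "star_set K" "measure lebesgue K = 1"
      using fK by (auto simp: feasible_def piecewise_constant_def)
    have diff: "((\<lambda>U. ?L \<rho> U - ?L ?R U) has_sum ((objective P Q K + lam * ?d) - (objective P Q K0 + lam * ?d))) \<U>"
      by (intro has_sum_diff opt_L[OF K0] lagr[where \<rho> = \<rho>, OF K'(1) \<rho> K'(2)])
    have "\<rho> U = ?R U" if "U \<in> \<U>" for U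
    proof (rule ccontr)
      assume ne: "\<rho> U \<noteq> ?R U"
      \<comment> \<open>A sum of nonnegative terms with a nonpositive value has only zero
        terms.\<close>
      have "?L \<rho> U - ?L ?R U = 0"
      proof (rule nonneg_has_sum_le_0D[OF diff _ _ that])
        show "(objective P Q K + lam * ?d) - (objective P Q K0 + lam * ?d) \<le> 0" using min by simp
        show "0 \<le> ?L \<rho> V - ?L ?R V" if "V \<in> \<U>" for V
          using less[OF that \<rho>(2)[OF that]] by (cases "\<rho> V = ?R V") auto
      qed
      then show False using less[OF that \<rho>(2)[OF that] ne] by simp
    qed
    then show ?thesis using \<rho>(1) K' fK by (auto simp: optimal_def feasible_def)
  qed
  then show "is_arg_min (objective P Q) (feasible \<epsilon> \<U>) K \<longleftrightarrow> optimal K" using opt_argmin by blast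
qed

section \<open>Existence of the scaling parameter\<close>

text \<open>A bound linear in \<open>y\<close>: multiplied by the area, it becomes a combination of
  areas and moments, hence summable over the blocks.\<close>

lemma power_le_one_plus_powr:
  fixes y :: real
  assumes "0 \<le> y"
  shows "(y powr (1 / (real n + 1))) ^ n \<le> 1 + y"
proof -
  define z where "z = y powr (1 / (real n + 1))"
  have z: "0 \<le> z" by (simp add: z_def)
  have y: "z ^ (n + 1) = y"
  proof (cases "y = 0")
    case False
    then have "z powr real (n + 1) = y" using assms by (simp add: z_def powr_powr add.commute)
    moreover have "0 < z" using False assms by (simp add: z_def)
    ultimately show ?thesis using powr_realpow[of z "n + 1"] by simp
  qed (simp add: z_def)
  have "z ^ n \<le> 1 + z ^ (n + 1)"
  proof (cases "z \<le> 1")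
    case True
    then have "z ^ n \<le> 1" using z by (simp add: power_le_one)
    then show ?thesis using z by (simp add: add_increasing2)
  next
    case False
    then have "z ^ n \<le> z ^ (n + 1)" by (intro power_increasing) auto
    then show ?thesis by simp
  qed
  then show ?thesis unfolding y unfolding z_def .
qed

lemma normalizing_exists:
  fixes \<U> :: "'a::euclidean_space set set" and p q :: "'a \<Rightarrow> real"
  assumes \<epsilon>: "0 < \<epsilon>" and \<U>: "open_partition_ae \<U>"
    and p: "p \<in> borel_measurable borel" "\<And>x. 0 \<le> p x" "integrable (density lebesgue (\<lambda>x. ennreal (p x))) norm"
    and q: "q \<in> borel_measurable borel" "\<And>x. 0 \<le> q x" "integrable (density lebesgue (\<lambda>x. ennreal (q x))) norm"
    and ball: "measure lebesgue (cball (0::'a) \<epsilon>) < 1"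
    and V: "V \<in> \<U>" "0 < moment_diff p q V"
  shows "\<exists>lam. normalizing \<epsilon> \<U> p q lam"
proof -
  let ?d = "DIM('a)"
  let ?\<sigma> = "\<lambda>U. max 0 (moment_diff p q U)"
  \<comment> \<open>At \<open>lam = 1 / s\<close>, \<open>y U s\<close> is the
    \<open>(?d + 1)\<close>-st power of the radius before the cut-off at \<epsilon>, and
    \<open>g U s\<close> is \<open>?d\<close> times the volume over \<open>U\<close>.\<close>
  define y where "y U s = ?\<sigma> U / (real ?d * area U) * s" for U s
  define g where "g U s = area U * (max \<epsilon> (y U s powr (1 / (real ?d + 1)))) ^ ?d" for U s
  have w: "0 < area U" if "U \<in> \<U>" for U by (rule open_partition_ae_area_pos[OF \<U> that])
  have y0: "0 \<le> y U s" if "0 \<le> s" for U s using that by (simp add: y_def area_nonneg)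
  have g0: "0 \<le> g U s" for U s using \<epsilon> by (simp add: g_def area_nonneg le_max_iff_disj)
  \<comment> \<open>The ball of radius \<epsilon> as a star set of constant radius yields both the
    value at \<open>s = 0\<close> and the summability of the areas.\<close>
  have area_sum: "((\<lambda>U. area U * \<epsilon> ^ ?d) has_sum (?d * measure lebesgue (cball (0::'a) \<epsilon>))) \<U>"
  proof -
    have star: "star_set (cball (0::'a) \<epsilon>)"
      unfolding star_set_def
      by (intro ballI closed_segment_subset convex_cball) (use \<epsilon> in auto)
    have rad: "radial (cball (0::'a) \<epsilon>) u = ereal \<epsilon>" if "U \<in> \<U>" "u \<in> U" for U u
    proof -
      have "norm u = 1" using that open_partition_ae_sets[OF \<U> that(1)] sets_sphere_measure_borel by fastforce
      then have "{t. 0 \<le> t \<and> t *\<^sub>R u \<in> cball 0 \<epsilon>} = {0..\<epsilon>}" by auto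
      then have "radial (cball 0 \<epsilon>) u = (SUP t\<in>{0..\<epsilon>}. ereal t)" by (simp add: radial_def)
      also have "\<dots> = ereal \<epsilon>" using \<epsilon> by (intro antisym SUP_least SUP_upper) auto
      finally show ?thesis .
    qed
    have "0 < measure lebesgue (cball (0::'a) \<epsilon>)" using \<epsilon> by (simp add: content_cball_pos)
    then show ?thesis
      using measure_star_set_eq_iff[OF \<U> star rad \<epsilon>, where c = "?d * measure lebesgue (cball (0::'a) \<epsilon>)"] by simp
  qed
  have area_summable: "area summable_on \<U>"
    using summable_on_cmult_left[of "\<lambda>U. area U * \<epsilon> ^ ?d" \<U> "inverse (\<epsilon> ^ ?d)"] area_sum \<epsilon>
    by (auto simp: summable_on_def mult.assoc)
  have \<sigma>_summable: "?\<sigma> summable_on \<U>"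
  proof (rule summable_on_comparison_test)
    show "moment p summable_on \<U>" using has_sum_moment[OF \<U> p] by (auto simp: summable_on_def)
    fix U assume U: "U \<in> \<U>"
    show "?\<sigma> U \<le> moment p U"
      using moment_eq_nn_integral(2)[OF p(1,2) nn_integral_density_norm[OF p] open_partition_ae_sets[OF \<U> U]]
        moment_eq_nn_integral(2)[OF q(1,2) nn_integral_density_norm[OF q] open_partition_ae_sets[OF \<U> U]]
      by (simp add: moment_diff_def)
  qed simp
  \<comment> \<open>Chosen so that \<open>V\<close> alone suffices at \<open>s = S\<close>: there
    \<open>y V S = z ^ (?d + 1)\<close>, the radius is at least \<open>z\<close>, and
    \<open>area V * z ^ ?d \<ge> area V * z \<ge> ?d\<close>.\<close>
  define z where "z = max 1 (?d / area V)"
  define S where "S = z ^ (?d + 1) * (real ?d * area V) / moment_diff p q V"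
  have z: "1 \<le> z" "?d / area V \<le> z" by (auto simp: z_def)
  have S: "0 < S" using z w[OF V(1)] V(2) by (simp add: S_def)
  \<comment> \<open>The area cancels in \<open>area U * y U s\<close>, leaving
    \<open>s / ?d * ?\<sigma> U\<close>, and \<open>s \<le> S\<close> makes the majorant
    uniform.\<close>
  define M where "M U = (\<epsilon> ^ ?d + 1) * area U + S / ?d * ?\<sigma> U" for U
  have M_summable: "M summable_on \<U>"
    unfolding M_def by (intro summable_on_add summable_on_cmult_right area_summable \<sigma>_summable)
  have g_le: "norm (g U s) \<le> M U" if U: "U \<in> \<U>" and s: "s \<in> {0..S}" for U s
  proof -
    have "(max \<epsilon> (y U s powr (1 / (real ?d + 1)))) ^ ?d \<le> \<epsilon> ^ ?d + (y U s powr (1 / (real ?d + 1))) ^ ?d"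
      using \<epsilon> by (simp add: max_def)
    also have "\<dots> \<le> \<epsilon> ^ ?d + 1 + y U s" using power_le_one_plus_powr[OF y0, of s U ?d] s by simp
    finally have "g U s \<le> area U * (\<epsilon> ^ ?d + 1 + y U s)"
      unfolding g_def by (intro mult_left_mono) (auto simp: area_nonneg)
    also have "\<dots> = (\<epsilon> ^ ?d + 1) * area U + s / ?d * ?\<sigma> U" using w[OF U] by (simp add: y_def field_simps)
    also have "\<dots> \<le> M U" unfolding M_def using s by (intro add_left_mono mult_right_mono divide_right_mono) auto
    finally show ?thesis using g0 by simp
  qed
  have g_summable: "(\<lambda>U. g U s) summable_on \<U>" if "s \<in> {0..S}" for s
    by (rule summable_on_comparison_test[OF M_summable]) (use g_le[OF _ that] g0 in auto)
  let ?G = "\<lambda>s. \<Sum>\<^sub>\<infinity>U\<in>\<U>. g U s"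
  have cont: "continuous_on {0..S} ?G"
  proof (rule uniform_limit_theorem)
    show "uniform_limit {0..S} (\<lambda>F s. \<Sum>U\<in>F. g U s) ?G (finite_subsets_at_top \<U>)"
      by (rule Weierstrass_m_test_general[OF g_le M_summable])
    have "continuous_on {0..S} (g U)" for U
    proof -
      have "continuous_on {0..S} (\<lambda>s. y U s powr (1 / (real ?d + 1)))"
      proof (rule continuous_on_powr')
        show "continuous_on {0..S} (y U)"
          unfolding y_def[abs_def] by (intro continuous_on_mult continuous_on_const continuous_on_id)
      qed (auto simp: y0)
      then show ?thesis
        unfolding g_def[abs_def]
        by (intro continuous_on_mult continuous_on_power continuous_on_max continuous_on_const)
    qed
    then show "\<forall>\<^sub>F F in finite_subsets_at_top \<U>. continuous_on {0..S} (\<lambda>s. \<Sum>U\<in>F. g U s)"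
      by (intro always_eventually allI continuous_on_sum) auto
  qed simp
  have "?G 0 = (\<Sum>\<^sub>\<infinity>U\<in>\<U>. area U * \<epsilon> ^ ?d)"
    by (intro infsum_cong) (use \<epsilon> in \<open>simp add: g_def y_def\<close>)
  also have "\<dots> = ?d * measure lebesgue (cball (0::'a) \<epsilon>)" using area_sum by (rule infsumI)
  finally have G0: "?G 0 < ?d" using ball by simp
  have "real ?d \<le> area V * z" using z w[OF V(1)] by (simp add: field_simps)
  also have "\<dots> \<le> area V * z ^ ?d" using z by (intro mult_left_mono self_le_power) (auto simp: area_nonneg)
  also have "\<dots> \<le> g V S"
  proof -
    have "y V S = z ^ (?d + 1)" using V(2) w[OF V(1)] by (simp add: y_def S_def)
    also have "\<dots> = z powr (real ?d + 1)" using powr_realpow[of z "?d + 1"] z by (simp add: add.commute)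
    finally have "y V S powr (1 / (real ?d + 1)) = z" using z by (simp add: powr_powr)
    then show ?thesis unfolding g_def using z by (intro mult_left_mono power_mono) (auto simp: area_nonneg)
  qed
  also have "\<dots> \<le> ?G S"
    using finite_sum_le_infsum[OF g_summable, of S "{V}"] V(1) S g0 by simp
  finally have GS: "?d \<le> ?G S" .
  obtain s where s: "0 \<le> s" "s \<le> S" "?G s = ?d"
    using IVT'[OF _ GS _ cont] G0 S by auto
  \<comment> \<open>The strict inequality at the left endpoint keeps \<open>s\<close> positive, so
    \<open>1 / s\<close> is a genuine parameter.\<close>
  have "s \<noteq> 0" using s(3) G0 by auto
  then have s0: "0 < s" using s(1) by simp
  have "(\<Sum>\<^sub>\<infinity>U\<in>\<U>. area U * opt_radius \<epsilon> p q (1 / s) U ^ ?d) = ?G s"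
  proof (rule infsum_cong)
    fix U assume U: "U \<in> \<U>"
    have "?\<sigma> U / (real ?d * area U * (1 / s)) = y U s" using s0 by (simp add: y_def)
    then show "area U * opt_radius \<epsilon> p q (1 / s) U ^ ?d = g U s"
      using opt_radius_eq_max[OF \<epsilon> _ w[OF U], of "1 / s" p q] s0 by (simp add: g_def)
  qed
  then have "normalizing \<epsilon> \<U> p q (1 / s)" using s0 s(3) by (simp add: normalizing_def)
  then show ?thesis by blast
qed

text \<open>The second conjunct gives conditions under which a scaling parameter exists, so that the
  first is not vacuous.\<close>

theorem proposition5p5:
  fixes \<epsilon> :: real
    and P Q :: "'a::euclidean_space measure"
    and p q :: "'a \<Rightarrow> real"
    and \<U> :: "'a set set"
  assumes "0 < \<epsilon>"
    and "p \<in> borel_measurable borel" and "\<And>x. 0 \<le> p x"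
    and "P = density lebesgue (\<lambda>x. ennreal (p x))" and "prob_space P"
    and "q \<in> borel_measurable borel" and "\<And>x. 0 \<le> q x"
    and "Q = density lebesgue (\<lambda>x. ennreal (q x))" and "prob_space Q"
    and "integrable P norm" and "integrable Q norm"
    and "open_partition_ae \<U>"
  shows "(\<forall>lam. normalizing \<epsilon> \<U> p q lam \<longrightarrow>
            (\<exists>K. is_arg_min (objective P Q) (feasible \<epsilon> \<U>) K) \<and>
            (\<forall>K. is_arg_min (objective P Q) (feasible \<epsilon> \<U>) K \<longleftrightarrow>
                   star_set K \<and> cball 0 \<epsilon> \<subseteq> K \<and>
                   (\<forall>U\<in>\<U>. \<forall>u\<in>U. radial K u = ereal (opt_radius \<epsilon> p q lam U)))) \<and>
         (measure lebesgue (cball (0::'a) \<epsilon>) < 1 \<and> (\<exists>U\<in>\<U>. 0 < moment_diff p q U) \<longrightarrow>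
            (\<exists>lam. normalizing \<epsilon> \<U> p q lam))"
proof -
  have p: "p \<in> borel_measurable borel" "\<And>x. 0 \<le> p x" "integrable (density lebesgue (\<lambda>x. ennreal (p x))) norm"
    and q: "q \<in> borel_measurable borel" "\<And>x. 0 \<le> q x" "integrable (density lebesgue (\<lambda>x. ennreal (q x))) norm"
    using assms by auto
  note arg_min = argmin_characterisation[OF assms(1,12) p q, folded assms(4,8)]
  note exists = normalizing_exists[OF assms(1,12) p q]
  show ?thesis using arg_min exists by blast
qed

end
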